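(* For any chordal graph $H$ with at least one edge, the graph $G(L(A(H)))$ has a Hamiltonian cycle.
   Context: A graph is chordal if it has no induced cycle of length at least $4$. For a graph $H=(V,E)$, a tube is a nonempty set $T\subseteq V$ such that the induced subgraph $H[T]$ is connected. Two tubes $T,T'$ are compatible if they are nested ($T\subset T'$ or $T'\subset T$) or non-adjacent ($H[T\cup T']$ is not connected). A tubing of $H$ is a family of pairwise compatible tubes that contains the vertex set of each connected component of $H$. The graph associahedron $A(H)$ is the polytope whose face lattice $L(A(H))$ is isomorphic to the reverse inclusion order of all tubings of $H$, together with the empty face $\emptyset$ as minimum (the vertices correspond to inclusion-maximal tubings). $G(L(A(H)))$ is the cover graph of $L(A(H))$: two tubings are adjacent iff one is obtained from the other by adding one tube, and $\emptyset$ is adjacent to every inclusion-maximal tubing. *)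

theory Defs
  imports "HOL-Analysis.Polytope" "Graph_Theory.Graph_Theory"
begin

text \<open>
  A finite simple graph is a \<^locale>\<open>pair_graph\<close>: an undirected edge between \<open>u\<close> and \<open>v\<close> is the pair
  of opposite arcs \<open>(u, v)\<close> and \<open>(v, u)\<close>. A cycle is given by the list of its arcs; the library's
  \<^const>\<open>pre_digraph.cycle\<close> also admits the closed walk \<open>[(u, v), (v, u)]\<close>, which is not a cycle of
  the undirected graph, so a lower bound on the length is always required explicitly.
\<close>

definition chordal :: "'v pair_pre_digraph \<Rightarrow> bool" where
  "chordal H \<longleftrightarrow>
    \<not> (\<exists>p. pre_digraph.cycle (with_proj H) p \<and> length p \<ge> 4 \<and>
           arcs (with_proj H \<restriction> (fst ` set p)) = set p \<union> (set p)\<inverse>)"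

definition has_hamiltonian_cycle :: "'v pair_pre_digraph \<Rightarrow> bool" where
  "has_hamiltonian_cycle G \<longleftrightarrow>
    (\<exists>p. pre_digraph.cycle (with_proj G) p \<and> length p \<ge> 3 \<and> fst ` set p = pverts G)"

definition covered_by :: "'a set \<Rightarrow> ('a \<Rightarrow> 'a \<Rightarrow> bool) \<Rightarrow> 'a \<Rightarrow> 'a \<Rightarrow> bool" where
  "covered_by A le x y \<longleftrightarrow>
    x \<in> A \<and> y \<in> A \<and> x \<noteq> y \<and> le x y \<and> \<not> (\<exists>z\<in>A. z \<noteq> x \<and> z \<noteq> y \<and> le x z \<and> le z y)"

definition cover_graph :: "'a set \<Rightarrow> ('a \<Rightarrow> 'a \<Rightarrow> bool) \<Rightarrow> 'a pair_pre_digraph" where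
  "cover_graph A le =
    \<lparr> pverts = A, parcs = {(x, y). covered_by A le x y \<or> covered_by A le y x} \<rparr>"

definition tube :: "'v pair_pre_digraph \<Rightarrow> 'v set \<Rightarrow> bool" where
  "tube H T \<longleftrightarrow>
    T \<noteq> {} \<and> T \<subseteq> pverts H \<and> Digraph_Component.connected (with_proj H \<restriction> T)"

definition compatible_tubes :: "'v pair_pre_digraph \<Rightarrow> 'v set \<Rightarrow> 'v set \<Rightarrow> bool" where
  "compatible_tubes H T T' \<longleftrightarrow>
    T \<subset> T' \<or> T' \<subset> T \<or> \<not> Digraph_Component.connected (with_proj H \<restriction> (T \<union> T'))"

text \<open>
  As \<open>H\<close> is symmetric, its strongly connected components are its connected components.
\<close>

definition tubing :: "'v pair_pre_digraph \<Rightarrow> 'v set set \<Rightarrow> bool" where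
  "tubing H X \<longleftrightarrow>
    (\<forall>T\<in>X. tube H T) \<and> pairwise (compatible_tubes H) X \<and> pre_digraph.sccs_verts (with_proj H) \<subseteq> X"

text \<open>
  The lattice \<open>L(A(H))\<close>: \<^const>\<open>None\<close> stands for the empty face, and \<open>Some X\<close> for the
  nonempty face corresponding to the tubing \<open>X\<close>.
\<close>

definition tubing_lattice :: "'v pair_pre_digraph \<Rightarrow> 'v set set option set" where
  "tubing_lattice H = insert None (Some ` {X. tubing H X})"

fun tubing_le :: "'v set set option \<Rightarrow> 'v set set option \<Rightarrow> bool" where
  "tubing_le None _ = True"
| "tubing_le (Some X) None = False"
| "tubing_le (Some X) (Some Y) = (Y \<subseteq> X)"

definition graph_associahedron ::
    "'v pair_pre_digraph \<Rightarrow> 'n::euclidean_space set \<Rightarrow> bool" where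
  "graph_associahedron H P \<longleftrightarrow>
    polytope P \<and>
    (\<exists>f. bij_betw f {F. F face_of P} (tubing_lattice H) \<and>
         (\<forall>F G. F face_of P \<longrightarrow> G face_of P \<longrightarrow> (F \<subseteq> G \<longleftrightarrow> tubing_le (f F) (f G))))"

end

theory Submission
  imports Defs
begin

text \<open>
  A chordal graph has a simplicial vertex \<open>v\<close>. Deleting \<open>v\<close> from all tubes of a tubing of \<open>H\<close> gives a
  tubing of \<open>H - v\<close>. The neighbours of \<open>v\<close> form a clique, so the tubes of a tubing \<open>Y\<close> of \<open>H - v\<close> that
  meet them form a chain, and the tubings of \<open>H\<close> over \<open>Y\<close> form a path in the cover graph: \<open>v\<close> moves
  along the chain. The ends of this path are adjacent to the respective ends of the paths over the
  neighbours of \<open>Y\<close>, and they are maximal tubings if \<open>Y\<close> is. By induction there is a Hamiltonian path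
  through all tubings of \<open>H\<close> between two maximal ones: traverse the paths over the tubings of \<open>H - v\<close>
  alternately forwards and backwards. The empty face closes it to a cycle.
\<close>

section \<open>Connected sets and simplicial vertices\<close>

text \<open>Simpliciality enters twice. A tube stays connected when \<open>v\<close> is deleted,
  because a passage through \<open>v\<close> can take the edge between its two neighbours instead.
  And any two tubes of H - v that contain neighbours of \<open>v\<close> touch, so compatibility
  forces them to be nested; this is what makes each fibre a path. The obstacle is closing the cycle.
  The empty face is adjacent only to maximal tubings, so the statement carried through the induction
  is about a path with two maximal ends, not about a cycle. The number of tubings of H - v may have
  either parity, so the last fibre may be left at either end; this does no harm, since both ends of
  the fibre over a maximal tubing are maximal. Chordality is only a source of simplicial vertices
  and is inherited by induced subgraphs. The edge of H guarantees a second tubing, so that the path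
  together with the empty face has at least three vertices.\<close>

definition conn :: "'v rel \<Rightarrow> 'v set \<Rightarrow> bool" where
  "conn E T \<longleftrightarrow> T \<noteq> {} \<and>
    (\<forall>A\<subseteq>T. A \<noteq> {} \<longrightarrow> (\<forall>x\<in>A. \<forall>y\<in>T. (x, y) \<in> E \<longrightarrow> y \<in> A) \<longrightarrow> A = T)"

text \<open>For connected \<open>S\<close> and \<open>T\<close> this amounts to connectedness of the
  union; a shared vertex counts as much as an edge. Compatibility then needs no reference to the
  union.\<close>

definition touch :: "'v rel \<Rightarrow> 'v set \<Rightarrow> 'v set \<Rightarrow> bool" where
  "touch E S T \<longleftrightarrow> (\<exists>x\<in>S. \<exists>y\<in>T. x = y \<or> (x, y) \<in> E)"

definition comps :: "'v rel \<Rightarrow> 'v set \<Rightarrow> 'v set set" where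
  "comps E V = {C. C \<subseteq> V \<and> conn E C \<and> (\<forall>D. conn E D \<longrightarrow> C \<subseteq> D \<longrightarrow> D \<subseteq> V \<longrightarrow> D = C)}"

definition simplicial :: "'v rel \<Rightarrow> 'v set \<Rightarrow> 'v \<Rightarrow> bool" where
  "simplicial E V v \<longleftrightarrow>
    (\<forall>a\<in>V. \<forall>b\<in>V. (v, a) \<in> E \<longrightarrow> (v, b) \<in> E \<longrightarrow> a \<noteq> b \<longrightarrow> (a, b) \<in> E)"

definition induced_path :: "'v rel \<Rightarrow> 'v list \<Rightarrow> bool" where
  "induced_path E p \<longleftrightarrow> distinct p \<and>
    (\<forall>i<length p. \<forall>j<length p. (p ! i, p ! j) \<in> E \<longleftrightarrow> j = Suc i \<or> i = Suc j)"

text \<open>A hole cut open at \<open>x\<close>: at least three path vertices mean a cycle of length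
  at least four. Dirac's argument produces holes in this shape, and shrinking \<open>V\<close>
  preserves the condition.\<close>

definition hole_free :: "'v rel \<Rightarrow> 'v set \<Rightarrow> bool" where
  "hole_free E V \<longleftrightarrow>
    (\<forall>x p. x \<in> V \<longrightarrow> set p \<subseteq> V \<longrightarrow> x \<notin> set p \<longrightarrow> length p \<ge> 3 \<longrightarrow> induced_path E p \<longrightarrow>
      \<not> (\<forall>u\<in>set p. (x, u) \<in> E \<longleftrightarrow> u = hd p \<or> u = last p))"

lemma connI:
  assumes "T \<noteq> {}"
    and "\<And>A. A \<subseteq> T \<Longrightarrow> A \<noteq> {} \<Longrightarrow> (\<And>x y. x \<in> A \<Longrightarrow> y \<in> T \<Longrightarrow> (x, y) \<in> E \<Longrightarrow> y \<in> A) \<Longrightarrow> A = T"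
  shows "conn E T"
  using assms unfolding conn_def by metis

text \<open>Most connectedness arguments take this form: exhibit a nonempty subset closed under
  neighbours and conclude that it is everything, with no walks to cut or join.\<close>

lemma connD:
  assumes "conn E T" "A \<subseteq> T" "A \<noteq> {}"
    and "\<And>x y. x \<in> A \<Longrightarrow> y \<in> T \<Longrightarrow> (x, y) \<in> E \<Longrightarrow> y \<in> A"
  shows "A = T"
  using assms unfolding conn_def by metis

lemma conn_nonempty: "conn E T \<Longrightarrow> T \<noteq> {}"
  by (simp add: conn_def)

lemma conn_singleton: "conn E {v}"
  by (rule connI) auto

lemma hole_free_subset: "hole_free E V \<Longrightarrow> W \<subseteq> V \<Longrightarrow> hole_free E W"
  unfolding hole_free_def by (meson subset_iff)

lemma touch_mono: "touch E S T \<Longrightarrow> S \<subseteq> S' \<Longrightarrow> T \<subseteq> T' \<Longrightarrow> touch E S' T'"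
  unfolding touch_def by blast

text \<open>The relation stays fixed while vertex sets vary. Since \<open>conn\<close> and
  \<open>comps\<close> inspect \<open>E\<close> only inside the given set, induced subgraphs need no
  relation of their own.\<close>

locale simple_graph =
  fixes E :: "'v rel"
  assumes E_sym: "(x, y) \<in> E \<Longrightarrow> (y, x) \<in> E"
    and E_irrefl: "(x, x) \<notin> E"
begin

lemma touch_commute: "touch E S T \<longleftrightarrow> touch E T S"
  unfolding touch_def using E_sym by blast

lemma conn_Un:
  assumes S: "conn E S" and T: "conn E T" and "touch E S T"
  shows "conn E (S \<union> T)"
proof (rule connI)
  show "S \<union> T \<noteq> {}" using conn_nonempty[OF S] by blast
  fix A assume A: "A \<subseteq> S \<union> T" "A \<noteq> {}"
    and cl: "\<And>x y. x \<in> A \<Longrightarrow> y \<in> S \<union> T \<Longrightarrow> (x, y) \<in> E \<Longrightarrow> y \<in> A"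
  have 1: "A \<inter> S = {} \<or> A \<inter> S = S"
    using connD[OF S, of "A \<inter> S"] cl by blast
  have 2: "A \<inter> T = {} \<or> A \<inter> T = T"
    using connD[OF T, of "A \<inter> T"] cl by blast
  obtain x y where xy: "x \<in> S" "y \<in> T" "x = y \<or> (x, y) \<in> E"
    using \<open>touch E S T\<close> unfolding touch_def by blast
  have "x \<in> A \<longleftrightarrow> y \<in> A" using xy cl E_sym by blast
  then show "A = S \<union> T" using 1 2 A xy by blast
qed

lemma touch_if_conn_Un:
  assumes "conn E (S \<union> T)" "S \<noteq> {}" "T \<noteq> {}"
  shows "touch E S T"
proof (rule ccontr)
  assume "\<not> touch E S T"
  then have "S = S \<union> T"
    using assms by (intro connD[OF assms(1)]) (auto simp: touch_def)
  then show False using \<open>\<not> touch E S T\<close> assms(3) unfolding touch_def by blast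
qed

lemma conn_insert:
  assumes "conn E T" "u \<in> T" "(v, u) \<in> E"
  shows "conn E (insert v T)"
  using conn_Un[OF conn_singleton assms(1), of v] assms by (auto simp: touch_def)

lemma exists_comp:
  assumes "finite V" "T \<subseteq> V" "conn E T"
  obtains C where "C \<in> comps E V" "T \<subseteq> C"
proof -
  let ?F = "{D. D \<subseteq> V \<and> conn E D \<and> T \<subseteq> D}"
  have "finite ?F" by (rule finite_subset[of _ "Pow V"]) (use assms(1) in auto)
  moreover have "T \<in> ?F" using assms by simp
  ultimately obtain C where "C \<in> ?F" "\<forall>D\<in>?F. C \<subseteq> D \<longrightarrow> C = D"
    using finite_has_maximal[of ?F] by blast
  then have "C \<in> comps E V" "T \<subseteq> C" unfolding comps_def by blast+
  then show thesis by (rule that)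
qed

lemma comps_absorb:
  assumes "C \<in> comps E V" "conn E T" "T \<subseteq> V" "touch E C T"
  shows "T \<subseteq> C"
proof -
  have "conn E (C \<union> T)" using assms by (auto simp: comps_def intro: conn_Un)
  then have "C \<union> T = C" using assms unfolding comps_def by blast
  then show ?thesis by blast
qed

lemma comps_touch_eq:
  assumes "C \<in> comps E V" "D \<in> comps E V" "touch E C D"
  shows "C = D"
proof
  show "D \<subseteq> C" using assms by (intro comps_absorb[of C V]) (auto simp: comps_def)
  show "C \<subseteq> D" using assms touch_commute[of C D]
    by (intro comps_absorb[of D V]) (auto simp: comps_def)
qed

lemma conn_walk:
  assumes T: "conn E T" and "a \<in> T" "b \<in> T"
  shows "\<exists>p. p \<noteq> [] \<and> hd p = a \<and> last p = b \<and> set p \<subseteq> T \<and> successively (\<lambda>x y. (x, y) \<in> E) p"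
proof -
  let ?W = "\<lambda>b p. p \<noteq> [] \<and> hd p = a \<and> last p = b \<and> set p \<subseteq> T \<and>
    successively (\<lambda>x y. (x, y) \<in> E) p"
  let ?A = "{b \<in> T. \<exists>p. ?W b p}"
  have "?A = T"
  proof (rule connD[OF T])
    have "?W a [a]" using \<open>a \<in> T\<close> by simp
    then show "?A \<noteq> {}" using \<open>a \<in> T\<close> by blast
    fix x y assume "x \<in> ?A" and y: "y \<in> T" "(x, y) \<in> E"
    then obtain p where "?W x p" by blast
    then have "?W y (p @ [y])" using y by (auto simp: successively_append_iff)
    then show "y \<in> ?A" using y by blast
  qed auto
  then show ?thesis using \<open>b \<in> T\<close> by blast
qed

text \<open>A shortest walk is an induced path: a chord or a repeated vertex would give a shorter
  one.\<close>

lemma conn_induced_path: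
  assumes "conn E T" "a \<in> T" "b \<in> T"
  obtains p where "p \<noteq> []" "hd p = a" "last p = b" "set p \<subseteq> T" "induced_path E p"
proof -
  let ?W = "\<lambda>p. p \<noteq> [] \<and> hd p = a \<and> last p = b \<and> set p \<subseteq> T \<and>
    successively (\<lambda>x y. (x, y) \<in> E) p"
  obtain p0 where "?W p0" using conn_walk[OF assms] by blast
  then obtain p where p: "?W p" and min: "\<And>q. ?W q \<Longrightarrow> length p \<le> length q"
    using ex_has_least_nat[of ?W p0 length] by blast
  let ?s = "successively (\<lambda>x y. (x, y) \<in> E)"
  have take_s: "?s (take i p)" for i using p by (auto simp: successively_conv_nth)
  have drop_s: "?s (drop i p)" for i using p by (auto simp: successively_conv_nth)
  have shortcut: "j \<le> Suc i" if ij: "i < j" "j < length p" "(p ! i, p ! j) \<in> E" for i j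
  proof (rule ccontr)
    assume "\<not> j \<le> Suc i"
    let ?q = "take (Suc i) p @ drop j p"
    have 1: "?s (take (Suc i) p)" "?s (drop j p)"
      using take_s drop_s by blast+
    have ne: "take (Suc i) p \<noteq> []" "drop j p \<noteq> []" using ij by auto
    have "last (take (Suc i) p) = p ! i" using ij by (simp add: take_Suc_conv_app_nth)
    moreover have "hd (drop j p) = p ! j" using ij by (simp add: hd_drop_conv_nth)
    ultimately have "?s ?q" using 1 ne ij by (auto simp: successively_append_iff)
    moreover have "hd ?q = a" using p ne by (simp add: hd_append)
    moreover have "last ?q = b" using p ne by (simp add: last_append last_drop)
    moreover have "set ?q \<subseteq> T" using p set_take_subset[of "Suc i" p] set_drop_subset[of j p] by auto
    ultimately have "length p \<le> length ?q" using ne by (intro min) auto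
    then show False using ij \<open>\<not> j \<le> Suc i\<close> by simp
  qed
  have neq: "p ! i \<noteq> p ! j" if ij: "i < j" "j < length p" for i j
  proof
    assume eq: "p ! i = p ! j"
    show False
    \<comment> \<open>If the start is repeated, the walk can begin at its later occurrence.
      Otherwise the predecessor of \<open>p ! i\<close> is also adjacent to \<open>p ! j\<close>,
      which is a chord excluded by \<open>shortcut\<close>.\<close>
    proof (cases "i = 0")
      case True
      let ?q = "drop j p"
      have "?s ?q" by (rule drop_s)
      moreover have "hd ?q = a" using eq p True ij by (metis hd_conv_nth hd_drop_conv_nth)
      moreover have "last ?q = b" using p ij by simp
      moreover have "set ?q \<subseteq> T" using p set_drop_subset[of j p] by auto
      ultimately have "length p \<le> length ?q" using ij by (intro min) auto
      then show False using ij by simp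
    next
      case False
      then obtain k where k: "i = Suc k" by (cases i) auto
      have "(p ! k, p ! i) \<in> E" using p ij k by (simp add: successively_conv_nth)
      then have "j \<le> Suc k" using eq ij k by (intro shortcut) auto
      then show False using ij k by simp
    qed
  qed
  have "induced_path E p"
    unfolding induced_path_def
  proof (intro conjI allI impI)
    show "distinct p" using neq by (metis distinct_conv_nth linorder_neqE_nat)
    fix i j assume i: "i < length p" and j: "j < length p"
    show "(p ! i, p ! j) \<in> E \<longleftrightarrow> j = Suc i \<or> i = Suc j"
    proof
      assume e: "(p ! i, p ! j) \<in> E"
      consider "i < j" | "j < i" | "i = j" by linarith
      then show "j = Suc i \<or> i = Suc j"
        using shortcut[of i j] shortcut[of j i] e E_sym[OF e] i j E_irrefl by cases auto
    next
      assume "j = Suc i \<or> i = Suc j"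
      then show "(p ! i, p ! j) \<in> E"
        using p i j by (auto simp: successively_conv_nth intro: E_sym)
    qed
  qed
  then show thesis using p that by blast
qed

section \<open>Existence of simplicial vertices\<close>

text \<open>
  Dirac's argument: the vertices \<open>S\<close> adjacent to a component \<open>C\<close> of the non-neighbours of \<open>x\<close> form a
  clique, as otherwise an induced path through \<open>C\<close> together with \<open>x\<close> would be a hole. Every simplicial
  vertex of \<open>C \<union> S\<close> in \<open>C\<close> is simplicial.
\<close>

lemma exists_simplicial_nonneighbour:
  assumes "finite V" "hole_free E V" "x \<in> V" "y \<in> V" "x \<noteq> y" "(x, y) \<notin> E"
  shows "\<exists>z\<in>V. z \<noteq> x \<and> (x, z) \<notin> E \<and> simplicial E V z"
  using assms
proof (induction "card V" arbitrary: V x y rule: less_induct)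
  case less
  define U where "U = {u \<in> V. u \<noteq> x \<and> (x, u) \<notin> E}"
  have "finite U" "{y} \<subseteq> U" using less.prems by (auto simp: U_def)
  then obtain C where C: "C \<in> comps E U" and "y \<in> C"
    using exists_comp[OF _ _ conn_singleton] by (metis insert_subset)
  have CU: "C \<subseteq> U" and connC: "conn E C" using C by (auto simp: comps_def)
  define S where "S = {s \<in> V - C. \<exists>c\<in>C. (s, c) \<in> E}"
  have Sx: "(x, s) \<in> E \<and> s \<noteq> x" if s: "s \<in> S" for s
  proof -
    obtain c where c: "c \<in> C" "(s, c) \<in> E" "s \<in> V" "s \<notin> C" using s unfolding S_def by blast
    have "s \<noteq> x" using c CU by (auto simp: U_def)
    moreover have "s \<notin> U"
    proof
      assume "s \<in> U"
      then have "{s} \<subseteq> C" using c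
        by (intro comps_absorb[OF C conn_singleton]) (auto simp: touch_def intro: E_sym)
      then show False using c by simp
    qed
    ultimately show ?thesis using c by (auto simp: U_def)
  qed
  have clique: "(a, b) \<in> E" if ab: "a \<in> S" "b \<in> S" "a \<noteq> b" for a b
  proof (rule ccontr)
    assume nab: "(a, b) \<notin> E"
    obtain c where "c \<in> C" "(b, c) \<in> E" using ab by (auto simp: S_def)
    then have "conn E (insert b C)" by (intro conn_insert[OF connC])
    moreover obtain d where "d \<in> C" "(a, d) \<in> E" using ab by (auto simp: S_def)
    ultimately have connT: "conn E (insert a (insert b C))" by (intro conn_insert[of "insert b C" d]) auto
    obtain p where p: "p \<noteq> []" "hd p = a" "last p = b" "set p \<subseteq> insert a (insert b C)"
        "induced_path E p"
      by (rule conn_induced_path[OF connT, of a b]) auto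
    have xp: "\<forall>u\<in>set p. (x, u) \<in> E \<longleftrightarrow> u = hd p \<or> u = last p"
      using p CU Sx ab by (auto simp: U_def)
    have "x \<notin> set p" using p CU Sx ab by (auto simp: U_def)
    moreover have "set p \<subseteq> V" using p CU ab by (auto simp: U_def S_def)
    moreover have "length p \<ge> 3"
    proof (rule ccontr)
      assume "\<not> ?thesis"
      then consider "length p = 1" | "length p = 2" using p(1)
        by (metis One_nat_def Suc_1 length_0_conv less_Suc_eq not_less numeral_3_eq_3 less_one)
      then show False
      proof cases
        case 1 then show False using p ab by (cases p) auto
      next
        case 2
        then have "(p ! 0, p ! 1) \<in> E" using p(5) by (auto simp: induced_path_def)
        then show False using nab p 2 by (simp add: hd_conv_nth last_conv_nth)
      qed
    qed
    ultimately show False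
      using less.prems(2,3) xp p(5) unfolding hole_free_def by blast
  qed
  let ?W = "C \<union> S"
  have WV: "?W \<subseteq> V" using CU by (auto simp: S_def U_def)
  have "x \<notin> ?W" using CU Sx by (auto simp: U_def)
  then have small: "card ?W < card V"
    using WV less.prems by (intro psubset_card_mono) auto
  have lift: "?case" if z: "z \<in> C" "simplicial E ?W z" for z
  proof -
    have "a \<in> ?W" if "a \<in> V" "(z, a) \<in> E" for a
      using that z by (auto simp: S_def intro: E_sym)
    then have "simplicial E V z" using z(2) unfolding simplicial_def by blast
    then show ?thesis using z CU by (auto simp: U_def)
  qed
  have IH: "\<exists>z\<in>?W. z \<noteq> s \<and> (s, z) \<notin> E \<and> simplicial E ?W z"
    if "s \<in> ?W" "w \<in> ?W" "s \<noteq> w" "(s, w) \<notin> E" for s w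
    by (rule less.hyps[OF small finite_subset[OF WV] hole_free_subset[OF _ WV] that])
      (use less.prems in auto)
  \<comment> \<open>The induction hypothesis must deliver a vertex of \<open>C\<close>, not of
    \<open>S\<close>. A non-neighbour of some \<open>s\<close> in \<open>S\<close> cannot lie in the
    clique \<open>S\<close>; if \<open>S\<close> is adjacent to everything in \<open>?W\<close>,
    then neither can a non-neighbour of some \<open>c\<close> in \<open>C\<close>; and if
    \<open>?W\<close> is a clique, \<open>y\<close> itself will do.\<close>
  consider (1) s w where "s \<in> S" "w \<in> ?W" "s \<noteq> w" "(s, w) \<notin> E"
    | (2) c d where "\<forall>s\<in>S. \<forall>w\<in>?W. s \<noteq> w \<longrightarrow> (s, w) \<in> E" "c \<in> C" "d \<in> C" "c \<noteq> d" "(c, d) \<notin> E"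
    | (3) "\<forall>s\<in>?W. \<forall>w\<in>?W. s \<noteq> w \<longrightarrow> (s, w) \<in> E"
    using E_sym by blast
  then show ?case
  proof cases
    case 1
    then show ?thesis using IH[of s w] clique lift by blast
  next
    case 2
    then show ?thesis using IH[of c d] E_sym lift by blast
  next
    case 3
    then have "simplicial E ?W y" unfolding simplicial_def by blast
    then show ?thesis using lift \<open>y \<in> C\<close> by blast
  qed
qed

lemma exists_simplicial:
  assumes "finite V" "hole_free E V" "V \<noteq> {}"
  obtains v where "v \<in> V" "simplicial E V v"
proof (cases "\<forall>x\<in>V. \<forall>y\<in>V. x \<noteq> y \<longrightarrow> (x, y) \<in> E")
  case True
  obtain v where "v \<in> V" using assms(3) by blast
  moreover from this True have "simplicial E V v" unfolding simplicial_def by blast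
  ultimately show thesis by (rule that)
next
  case False
  then show thesis using exists_simplicial_nonneighbour[OF assms(1,2)] that by blast
qed

end

section \<open>Tubings and deletion of a simplicial vertex\<close>

text \<open>Inclusion is not strict here, so the middle clause holds trivially for
  \<open>S = T\<close> and needs no distinctness assumption.\<close>

definition tubings :: "'v rel \<Rightarrow> 'v set \<Rightarrow> 'v set set set" where
  "tubings E V = {X. (\<forall>T\<in>X. T \<subseteq> V \<and> conn E T) \<and>
    (\<forall>S\<in>X. \<forall>T\<in>X. S \<subseteq> T \<or> T \<subseteq> S \<or> \<not> touch E S T) \<and> comps E V \<subseteq> X}"

definition adjacent :: "'a set \<Rightarrow> 'a set \<Rightarrow> bool" where
  "adjacent X Y \<longleftrightarrow> (\<exists>a. a \<notin> X \<and> Y = insert a X \<or> a \<notin> Y \<and> X = insert a Y)"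

lemma adjacent_insert: "a \<notin> X \<Longrightarrow> adjacent X (insert a X)"
  unfolding adjacent_def by blast

lemma adjacent_commute: "adjacent X Y \<longleftrightarrow> adjacent Y X"
  unfolding adjacent_def by blast

text \<open>The largest member is split off and becomes the last value of \<open>t\<close>.
  Numbering a chain turns comparisons between its members into arithmetic on indices.\<close>

lemma chain_enumeration:
  assumes "finite A" "A \<noteq> {}" "\<And>S T. S \<in> A \<Longrightarrow> T \<in> A \<Longrightarrow> S \<subseteq> T \<or> T \<subseteq> S"
  shows "\<exists>(t :: nat \<Rightarrow> 'a set) k. t ` {..k} = A \<and> (\<forall>i j. i < j \<longrightarrow> j \<le> k \<longrightarrow> t i \<subset> t j)"
  using assms
proof (induction "card A" arbitrary: A rule: less_induct)
  case less
  obtain M where M: "M \<in> A" "\<forall>T\<in>A. M \<subseteq> T \<longrightarrow> M = T"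
    by (rule bexE[OF finite_has_maximal[OF less.prems(1,2)]])
  have top: "T \<subset> M" if "T \<in> A - {M}" for T
  proof -
    have "T \<in> A" "T \<noteq> M" using that by simp_all
    moreover have "T \<subseteq> M \<or> M \<subseteq> T" using \<open>T \<in> A\<close> M(1) by (rule less.prems(3))
    ultimately show ?thesis using M(2) by (metis psubset_eq)
  qed
  show ?case
  proof (cases "A - {M} = {}")
    case True
    then have "(\<lambda>_. M) ` {..0 :: nat} = A" using M(1) by auto
    then show ?thesis by (intro exI[of _ "\<lambda>_. M"] exI[of _ "0 :: nat"]) simp
  next
    case False
    have "card (A - {M}) < card A" using less.prems(1) M(1) by (rule card_Diff1_less)
    moreover have "finite (A - {M})" using less.prems(1) by simp
    moreover have "S \<subseteq> T \<or> T \<subseteq> S" if "S \<in> A - {M}" "T \<in> A - {M}" for S T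
      using that less.prems(3)[of S T] by blast
    ultimately have "\<exists>(t :: nat \<Rightarrow> 'a set) k. t ` {..k} = A - {M} \<and>
        (\<forall>i j. i < j \<longrightarrow> j \<le> k \<longrightarrow> t i \<subset> t j)"
      by (rule less.hyps[OF _ _ False])
    then obtain t :: "nat \<Rightarrow> 'a set" and k
      where t: "t ` {..k} = A - {M}" "\<forall>i j. i < j \<longrightarrow> j \<le> k \<longrightarrow> t i \<subset> t j"
      by (elim exE conjE)
    let ?t = "t(Suc k := M)"
    have "?t ` {..Suc k} = insert M (?t ` {..k})"
      by (simp only: atMost_Suc image_insert fun_upd_same)
    also have "?t ` {..k} = t ` {..k}"
      by (rule image_cong) auto
    finally have "?t ` {..Suc k} = A" using t(1) M(1) by (simp add: insert_absorb)
    moreover have "?t i \<subset> ?t j" if ij: "i < j" "j \<le> Suc k" for i j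
    proof (cases "j = Suc k")
      case True
      then have "t i \<in> t ` {..k}" using ij by simp
      then have "t i \<in> A - {M}" using t(1) by simp
      then show ?thesis using top[of "t i"] True ij(1) by simp
    next
      case False
      then show ?thesis using ij t(2) by simp
    qed
    ultimately show ?thesis by (intro exI[of _ ?t] exI[of _ "Suc k"]) simp
  qed
qed

lemma tubingsI:
  assumes "\<And>T. T \<in> X \<Longrightarrow> T \<subseteq> V \<and> conn E T"
    and "\<And>S T. S \<in> X \<Longrightarrow> T \<in> X \<Longrightarrow> S \<subseteq> T \<or> T \<subseteq> S \<or> \<not> touch E S T"
    and "comps E V \<subseteq> X"
  shows "X \<in> tubings E V"
  using assms by (simp add: tubings_def)

lemma tubings_member:
  assumes "X \<in> tubings E V" "T \<in> X"
  shows "T \<subseteq> V" "conn E T"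
  using assms by (simp_all add: tubings_def)

lemma tubings_compatible:
  assumes "X \<in> tubings E V" "S \<in> X" "T \<in> X"
  shows "S \<subseteq> T \<or> T \<subseteq> S \<or> \<not> touch E S T"
  using assms by (simp add: tubings_def)

lemma tubings_comps: "X \<in> tubings E V \<Longrightarrow> C \<in> comps E V \<Longrightarrow> C \<in> X"
  by (auto simp: tubings_def)

section \<open>Components, tubes and tubings under deletion of a simplicial vertex\<close>

locale simplicial_extension = simple_graph E for E :: "'v rel" +
  fixes V :: "'v set" and v :: 'v
  assumes finite_V: "finite V" and v_notin: "v \<notin> V"
    and simplicial_v: "simplicial E (insert v V) v"
begin

definition hits :: "'v set \<Rightarrow> bool" where
  "hits T \<longleftrightarrow> (\<exists>u\<in>T. (v, u) \<in> E)"

text \<open>The neighbours of \<open>v\<close> form a clique, so at most one component is hit. The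
  union makes \<open>C0\<close> empty if there is none, and \<open>insert v C0\<close> is the
  component of \<open>v\<close> in either case.\<close>

definition C0 :: "'v set" where
  "C0 = \<Union>{C \<in> comps E V. hits C}"

text \<open>The empty set arises from the tube \<open>{v}\<close> and is dropped.\<close>

definition proj :: "'v set set \<Rightarrow> 'v set set" where
  "proj X = (\<lambda>T. T - {v}) ` X - {{}}"

text \<open>The empty set is added as a bottom element: the tubes containing \<open>v\<close> are
  then uniformly of the form \<open>insert v T\<close> with \<open>T\<close> in the chain, including
  \<open>{v}\<close>.\<close>

definition chain :: "'v set set \<Rightarrow> 'v set set" where
  "chain Y = insert {} {T \<in> Y. hits T}"

text \<open>The end of the fibre at which \<open>v\<close> has been added to every member of the
  chain.\<close>

definition first :: "'v set set \<Rightarrow> 'v set set" where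
  "first Y = (Y - chain Y) \<union> insert v ` chain Y"

text \<open>The opposite end, at which \<open>v\<close> lies in no tube but its component.\<close>

definition final :: "'v set set \<Rightarrow> 'v set set" where
  "final Y = insert (insert v C0) Y"

lemma neighbours_adjacent:
  assumes "a \<in> V" "b \<in> V" "(v, a) \<in> E" "(v, b) \<in> E" "a \<noteq> b"
  shows "(a, b) \<in> E"
  using simplicial_v assms unfolding simplicial_def by blast

lemma hits_touch:
  assumes "S \<subseteq> V" "T \<subseteq> V" "hits S" "hits T"
  shows "touch E S T"
proof -
  obtain a b where "a \<in> S" "b \<in> T" "(v, a) \<in> E" "(v, b) \<in> E"
    using assms(3,4) unfolding hits_def by blast
  then show ?thesis using neighbours_adjacent[of a b] assms(1,2) unfolding touch_def by blast
qed

lemma hits_mono: "hits S \<Longrightarrow> S \<subseteq> T \<Longrightarrow> hits T"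
  unfolding hits_def by blast

lemma not_hits_empty: "\<not> hits {}"
  by (simp add: hits_def)

text \<open>Let \<open>A\<close> be closed in \<open>T - {v}\<close>. If it contains a neighbour
  \<open>a\<close> of \<open>v\<close>, then \<open>insert v A\<close> is closed in
  \<open>T\<close>, because all other neighbours of \<open>v\<close> in \<open>T\<close> are
  adjacent to \<open>a\<close>. If not, or if \<open>v\<close> is not in \<open>T\<close>, then
  \<open>A\<close> is already closed in \<open>T\<close>.\<close>

lemma conn_Diff:
  assumes T: "conn E T" "T \<subseteq> insert v V" and ne: "T - {v} \<noteq> {}"
  shows "conn E (T - {v})"
proof (rule connI[OF ne])
  fix A assume A: "A \<subseteq> T - {v}" "A \<noteq> {}"
    and cl: "\<And>x y. x \<in> A \<Longrightarrow> y \<in> T - {v} \<Longrightarrow> (x, y) \<in> E \<Longrightarrow> y \<in> A"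
  show "A = T - {v}"
  proof (cases "v \<in> T \<and> hits A")
    case True
    then obtain a where a: "a \<in> A" "(v, a) \<in> E" unfolding hits_def by blast
    have "insert v A = T"
    proof (rule connD[OF T(1)])
      show "insert v A \<subseteq> T" using A True by blast
      fix x y assume x: "x \<in> insert v A" and y: "y \<in> T" "(x, y) \<in> E"
      show "y \<in> insert v A"
      proof (cases "x = v")
        case True
        have "a \<in> V" "y = v \<or> y \<in> V" using a A T(2) y(1) by blast+
        then have "y = v \<or> y = a \<or> (a, y) \<in> E"
          using neighbours_adjacent[of a y] a y(2) True by blast
        then show ?thesis using cl[of a y] a(1) y(1) by blast
      next
        case False
        then show ?thesis using cl[of x y] x y by blast
      qed
    qed simp
    then show ?thesis using A by blast
  next
    case False
    have "A = T"
    proof (rule connD[OF T(1)])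
      show "A \<subseteq> T" using A by blast
      fix x y assume x: "x \<in> A" and y: "y \<in> T" "(x, y) \<in> E"
      have "y \<noteq> v" using False x y E_sym[OF y(2)] unfolding hits_def by blast
      then show "y \<in> A" using cl x y by blast
    qed (rule A)
    then show ?thesis using A by blast
  qed
qed

lemma hits_if_conn_insert:
  assumes "conn E (insert v T)" "T \<subseteq> V" "T \<noteq> {}"
  shows "hits T"
proof (rule ccontr)
  assume "\<not> hits T"
  then have "{v} = insert v T"
    using E_irrefl by (intro connD[OF assms(1)]) (auto simp: hits_def)
  then show False using assms v_notin by blast
qed

lemma hits_Diff:
  assumes "conn E T" "T \<subseteq> insert v V" "v \<in> T" "T - {v} \<noteq> {}"
  shows "hits (T - {v})"
  using assms by (intro hits_if_conn_insert) (auto simp: insert_absorb)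

lemma conn_insert_v:
  assumes "conn E T" "hits T"
  shows "conn E (insert v T)"
  using assms conn_insert unfolding hits_def by blast

lemma touch_insert_v:
  assumes "T \<subseteq> V"
  shows "touch E (insert v S) T \<longleftrightarrow> touch E S T \<or> hits T"
  using assms v_notin unfolding touch_def hits_def by blast

lemma comps_hits_eq: "C \<in> comps E V \<Longrightarrow> hits C \<Longrightarrow> C = C0"
proof -
  assume C: "C \<in> comps E V" "hits C"
  have "D = C" if "D \<in> comps E V" "hits D" for D
    using that C by (intro comps_touch_eq[of _ V] hits_touch) (auto simp: comps_def)
  then have "{C \<in> comps E V. hits C} = {C}" using C by blast
  then show "C = C0" by (simp add: C0_def)
qed

lemma C0_comp:
  assumes "T \<subseteq> V" "hits T"
  shows "C0 \<in> comps E V" "hits C0"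
proof -
  obtain u where u: "u \<in> V" "(v, u) \<in> E" using assms unfolding hits_def by blast
  then have "{u} \<subseteq> V" by simp
  then obtain C where C: "C \<in> comps E V" "{u} \<subseteq> C"
    using exists_comp[OF finite_V _ conn_singleton, of u] by metis
  then have "hits C" using u unfolding hits_def by blast
  then show "C0 \<in> comps E V" "hits C0" using C(1) comps_hits_eq[OF C(1)] by simp_all
qed

lemma subset_C0:
  assumes "conn E T" "T \<subseteq> V" "hits T"
  shows "T \<subseteq> C0"
  using assms C0_comp[OF assms(2,3)]
  by (intro comps_absorb[of C0 V] hits_touch) (auto simp: comps_def)

lemma C0_cases: "C0 = {} \<or> C0 \<in> comps E V \<and> hits C0"
  using comps_hits_eq unfolding C0_def by blast

lemma C0_subset: "C0 \<subseteq> V"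
  unfolding C0_def comps_def by blast

lemma insert_C0_comp: "insert v C0 \<in> comps E (insert v V)"
proof -
  have "conn E (insert v C0)"
    using C0_cases conn_singleton conn_insert_v by (auto simp: comps_def)
  moreover have "D = insert v C0"
    if D: "conn E D" "insert v C0 \<subseteq> D" "D \<subseteq> insert v V" for D
  proof (cases "D - {v} = {}")
    case True
    then show ?thesis using D by blast
  next
    case False
    then have "conn E (D - {v})" "hits (D - {v})" using conn_Diff hits_Diff D by blast+
    then have "D - {v} \<subseteq> C0" using D by (intro subset_C0) auto
    then show ?thesis using D by blast
  qed
  ultimately show ?thesis using C0_subset unfolding comps_def by blast
qed

lemma comps_insert: "comps E (insert v V) = insert (insert v C0) {C \<in> comps E V. \<not> hits C}"
proof (intro equalityI subsetI)
  fix C assume C: "C \<in> comps E (insert v V)"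
  then have conn: "conn E C" and sub: "C \<subseteq> insert v V" by (auto simp: comps_def)
  show "C \<in> insert (insert v C0) {C \<in> comps E V. \<not> hits C}"
  proof (cases "v \<in> C")
    case True
    then have "touch E C (insert v C0)" unfolding touch_def by blast
    then show ?thesis using comps_touch_eq[OF C insert_C0_comp] by blast
  next
    case False
    have "\<not> hits C"
    proof
      assume "hits C"
      then have "conn E (insert v C)" using conn conn_insert_v by blast
      then show False using C False sub unfolding comps_def by blast
    qed
    moreover have "C \<in> comps E V" using C False unfolding comps_def by blast
    ultimately show ?thesis by blast
  qed
next
  fix C assume "C \<in> insert (insert v C0) {C \<in> comps E V. \<not> hits C}"
  then consider "C = insert v C0" | "C \<in> comps E V" "\<not> hits C" by blast
  then show "C \<in> comps E (insert v V)"
  proof cases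
    case 1
    then show ?thesis using insert_C0_comp by simp
  next
    case 2
    have "D = C" if D: "conn E D" "C \<subseteq> D" "D \<subseteq> insert v V" for D
    proof -
      have CV: "C \<subseteq> V" "C \<noteq> {}" using 2 conn_nonempty by (auto simp: comps_def)
      then have ne: "D - {v} \<noteq> {}" using D v_notin by blast
      have "conn E (D - {v})" using conn_Diff D ne by blast
      moreover have "C \<subseteq> D - {v}" using D CV v_notin by blast
      moreover have "D - {v} \<subseteq> V" using D by blast
      ultimately have eq: "D - {v} = C" using 2 unfolding comps_def by blast
      then have "v \<notin> D" using hits_Diff[of D] D ne 2 by auto
      then show ?thesis using eq by blast
    qed
    then show ?thesis using 2 unfolding comps_def by blast
  qed
qed

text \<open>Deleting \<open>v\<close> preserves inclusions and creates no new contacts, so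
  compatibility survives; connectedness survives by \<open>conn_Diff\<close>.\<close>

lemma proj_tubing:
  assumes X: "X \<in> tubings E (insert v V)"
  shows "proj X \<in> tubings E V"
proof (rule tubingsI)
  fix T assume "T \<in> proj X"
  then obtain T' where T': "T' \<in> X" "T = T' - {v}" "T \<noteq> {}" by (auto simp: proj_def)
  then have "T' \<subseteq> insert v V" "conn E T'" using X by (auto simp: tubings_def)
  then show "T \<subseteq> V \<and> conn E T" using T' conn_Diff by blast
next
  fix S T assume "S \<in> proj X" "T \<in> proj X"
  then obtain S' T' where "S' \<in> X" "S = S' - {v}" "T' \<in> X" "T = T' - {v}"
    by (auto simp: proj_def)
  moreover from this have "S' \<subseteq> T' \<or> T' \<subseteq> S' \<or> \<not> touch E S' T'"
    using X by (auto simp: tubings_def)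
  ultimately show "S \<subseteq> T \<or> T \<subseteq> S \<or> \<not> touch E S T"
    using touch_mono[of E S T S' T'] by blast
next
  show "comps E V \<subseteq> proj X"
  proof
    fix C assume C: "C \<in> comps E V"
    then have CV: "C \<subseteq> V" "C \<noteq> {}" using conn_nonempty by (auto simp: comps_def)
    have "\<exists>T\<in>X. C = T - {v}"
    proof (cases "hits C")
      case True
      then have "C = insert v C0 - {v}" using comps_hits_eq[OF C] v_notin CV by blast
      moreover have "insert v C0 \<in> X" using X insert_C0_comp by (auto simp: tubings_def)
      ultimately show ?thesis by blast
    next
      case False
      then have "C \<in> X" using X C comps_insert by (auto simp: tubings_def)
      moreover have "C = C - {v}" using CV v_notin by blast
      ultimately show ?thesis by blast
    qed
    then show "C \<in> proj X" using CV by (auto simp: proj_def)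
  qed
qed

lemma finite_tubing: "Y \<in> tubings E V \<Longrightarrow> finite Y"
  by (rule finite_subset[of _ "Pow V"]) (use finite_V in \<open>auto simp: tubings_def\<close>)


lemma tubing_memberD:
  assumes "Y \<in> tubings E V" "T \<in> Y"
  shows "T \<subseteq> V" "conn E T" "T \<noteq> {}" "v \<notin> T"
proof -
  show "T \<subseteq> V" "conn E T" using tubings_member[OF assms] .
  then show "T \<noteq> {}" "v \<notin> T" using conn_nonempty v_notin by blast+
qed

lemma chain_subset_C0:
  assumes "Y \<in> tubings E V" "T \<in> chain Y"
  shows "T \<subseteq> C0"
  using assms subset_C0[of T] tubing_memberD[OF assms(1), of T] unfolding chain_def by blast

lemma C0_in_chain:
  assumes "Y \<in> tubings E V"
  shows "C0 \<in> chain Y"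
  using C0_cases tubings_comps[OF assms, of C0] unfolding chain_def by blast

lemma chain_total:
  assumes Y: "Y \<in> tubings E V" and "S \<in> chain Y" "T \<in> chain Y"
  shows "S \<subseteq> T \<or> T \<subseteq> S"
proof (cases "S = {} \<or> T = {}")
  case False
  then have ST: "S \<in> Y" "hits S" "T \<in> Y" "hits T" using assms by (auto simp: chain_def)
  then have "touch E S T" using tubing_memberD[OF Y] by (intro hits_touch) auto
  then show ?thesis using tubings_compatible[OF Y ST(1,3)] by blast
qed auto

text \<open>A tube outside the chain has no neighbour of \<open>v\<close>. Hence adding
  \<open>v\<close> to \<open>T\<close> creates no contact with it, and it cannot contain a nonempty
  member of the chain.\<close>

lemma insert_v_compatible:
  assumes Y: "Y \<in> tubings E V" and "S \<in> Y - chain Y" "T \<in> chain Y"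
  shows "S \<subseteq> T \<or> \<not> touch E (insert v T) S"
proof -
  have S: "S \<in> Y" "\<not> hits S" "S \<subseteq> V" using assms tubing_memberD[OF Y] by (auto simp: chain_def)
  have "S \<subseteq> T \<or> \<not> touch E T S"
  proof (cases "T = {}")
    case False
    then have T: "T \<in> Y" "hits T" using assms by (auto simp: chain_def)
    then have "\<not> T \<subseteq> S" using S hits_mono by blast
    then show ?thesis using tubings_compatible[OF Y S(1) T(1)] touch_commute[of S T] by blast
  qed (simp add: touch_def)
  then show ?thesis using S touch_insert_v by blast
qed

end

section \<open>The fibre over one tubing\<close>

text \<open>
  Let \<open>{} = t 0 \<subset> \<dots> \<subset> t k = C0\<close> be the chain of tubes meeting the clique of neighbours of \<open>v\<close>. A
  tubing over \<open>Y\<close> contains exactly the \<open>t i\<close> with \<open>2 * i \<le> n\<close> and the \<open>insert v (t i)\<close> with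
  \<open>n \<le> 2 * i\<close> for some \<open>n \<le> 2 * k\<close>, and these tubings form a path.
\<close>

locale tubing_fibre = simplicial_extension E V v for E :: "'v rel" and V v +
  fixes Y :: "'v set set" and t :: "nat \<Rightarrow> 'v set" and k :: nat
  assumes Y: "Y \<in> tubings E V" and t: "t ` {..k} = chain Y"
    and t_less: "i < j \<Longrightarrow> j \<le> k \<Longrightarrow> t i \<subset> t j"
begin

text \<open>Index 0 is excluded because \<open>t 0\<close> is empty and thus no tube;
  \<open>high\<close> admits it, as \<open>insert v (t 0)\<close> is the tube
  \<open>{v}\<close>.\<close>

definition low :: "nat \<Rightarrow> nat set" where
  "low n = {i. 1 \<le> i \<and> i \<le> k \<and> 2 * i \<le> n}"

definition high :: "nat \<Rightarrow> nat set" where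
  "high n = {i. i \<le> k \<and> n \<le> 2 * i}"

text \<open>The factor 2 provides half steps. At \<open>n = 2 * i\<close> both \<open>t i\<close>
  and \<open>insert v (t i)\<close> qualify, at odd \<open>n\<close> every index has exactly one
  version. Passing from \<open>2 * i\<close> to its successor removes \<open>insert v (t i)\<close>;
  the next step adds \<open>t (Suc i)\<close>.\<close>

definition node :: "nat \<Rightarrow> 'v set set" where
  "node n = (Y - chain Y) \<union> t ` low n \<union> (\<lambda>i. insert v (t i)) ` high n"

lemmas YD = tubing_memberD[OF Y]

lemma t_chain: "i \<le> k \<Longrightarrow> t i \<in> chain Y"
  using t by blast

lemma chainE:
  assumes "T \<in> chain Y"
  obtains i where "i \<le> k" "T = t i"
proof -
  have "T \<in> t ` {..k}" using assms t by simp
  then show thesis using that by auto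
qed

lemma t_mono: "i \<le> j \<Longrightarrow> j \<le> k \<Longrightarrow> t i \<subseteq> t j"
  using t_less[of i j] by (cases "i = j") auto

lemma t_le: "t i \<subseteq> t j \<Longrightarrow> i \<le> k \<Longrightarrow> j \<le> k \<Longrightarrow> i \<le> j"
  using t_less[of j i] by (cases "i \<le> j") auto

lemma t_eq: "i \<le> k \<Longrightarrow> j \<le> k \<Longrightarrow> t i = t j \<longleftrightarrow> i = j"
  using t_le[of i j] t_le[of j i] by auto

lemma t_0: "t 0 = {}"
proof -
  have "{} \<in> chain Y" by (simp add: chain_def)
  then obtain i where "i \<le> k" "{} = t i" by (rule chainE)
  then show ?thesis using t_mono[of 0 i] by simp
qed

lemma t_k: "t k = C0"
proof
  show "t k \<subseteq> C0" using t_chain chain_subset_C0[OF Y] by simp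
  obtain i where "i \<le> k" "C0 = t i" using C0_in_chain[OF Y] by (rule chainE)
  then show "C0 \<subseteq> t k" using t_mono[of i k] by simp
qed

lemma t_subset:
  assumes "i \<le> k"
  shows "t i \<subseteq> V" "v \<notin> t i"
  using chain_subset_C0[OF Y t_chain[OF assms]] C0_subset v_notin by blast+

lemma t_tube:
  assumes "1 \<le> i" "i \<le> k"
  shows "t i \<in> Y" "hits (t i)" "t i \<noteq> {}"
proof -
  have "t i \<noteq> {}" using t_less[of 0 i] assms by auto
  then show "t i \<in> Y" "hits (t i)" "t i \<noteq> {}"
    using t_chain[OF assms(2)] by (auto simp: chain_def)
qed

lemma tube_in_chainE:
  assumes "T \<in> Y" "T \<in> chain Y"
  obtains i where "1 \<le> i" "i \<le> k" "T = t i"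
proof -
  obtain i where i: "i \<le> k" "T = t i" using assms(2) by (rule chainE)
  moreover have "i \<noteq> 0" using i(2) t_0 YD(3)[OF assms(1)] by metis
  ultimately show thesis by (intro that[of i]) auto
qed

lemma conn_insert_t: "i \<le> k \<Longrightarrow> conn E (insert v (t i))"
  using t_tube[of i] YD(2)[of "t i"] t_0 conn_singleton conn_insert_v by (cases "i = 0") auto

lemma insert_t_eq: "i \<le> k \<Longrightarrow> j \<le> k \<Longrightarrow> insert v (t i) = insert v (t j) \<longleftrightarrow> i = j"
  using t_subset(2)[of i] t_subset(2)[of j] t_eq[of i j] by (simp add: insert_ident)

lemma node_cases:
  assumes "T \<in> node n"
  obtains (tube) "T \<in> Y - chain Y" | (low) i where "i \<in> low n" "T = t i"
    | (high) i where "i \<in> high n" "T = insert v (t i)"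
  using assms unfolding node_def by (elim UnE imageE) auto

lemma insert_t_in_node:
  assumes "i \<le> k"
  shows "insert v (t i) \<in> node n \<longleftrightarrow> n \<le> 2 * i"
proof
  assume "insert v (t i) \<in> node n"
  then show "n \<le> 2 * i"
  proof (cases rule: node_cases)
    case tube
    then show ?thesis using YD(4)[of "insert v (t i)"] by simp
  next
    case (low j)
    then show ?thesis using t_subset(2)[of j] by (auto simp: low_def)
  next
    case (high j)
    then show ?thesis using insert_t_eq[OF assms, of j] by (simp add: high_def)
  qed
next
  assume "n \<le> 2 * i"
  then show "insert v (t i) \<in> node n" using assms by (simp add: node_def high_def)
qed

lemma t_in_node:
  assumes "1 \<le> i" "i \<le> k"
  shows "t i \<in> node n \<longleftrightarrow> 2 * i \<le> n"
proof
  assume "t i \<in> node n"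
  then show "2 * i \<le> n"
  proof (cases rule: node_cases)
    case tube
    then show ?thesis using t_chain assms(2) by simp
  next
    case (low j)
    then show ?thesis using t_eq[OF assms(2), of j] by (simp add: low_def)
  next
    case (high j)
    then show ?thesis using t_subset(2)[OF assms(2)] by auto
  qed
next
  assume "2 * i \<le> n"
  then show "t i \<in> node n" using assms by (simp add: node_def low_def)
qed

text \<open>From \<open>2 * i \<le> n \<le> 2 * j\<close> follows \<open>i \<le> j\<close>: chain
  members without \<open>v\<close> lie below those with \<open>v\<close>. As they touch, nesting is
  their only way to be compatible.\<close>

lemma node_compatible:
  assumes "S \<in> node n" "v \<notin> S" "j \<in> high n"
  shows "S \<subseteq> insert v (t j) \<or> \<not> touch E (insert v (t j)) S"
proof -
  have j: "j \<le> k" "n \<le> 2 * j" using \<open>j \<in> high n\<close> by (auto simp: high_def)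
  from assms(1) show ?thesis
  proof (cases rule: node_cases)
    case tube
    then show ?thesis using insert_v_compatible[OF Y tube t_chain[OF j(1)]] by blast
  next
    case (low i)
    then have "i \<le> j" using j by (simp add: low_def)
    then show ?thesis using t_mono[of i j] j low by blast
  next
    case (high i)
    then show ?thesis using assms(2) by simp
  qed
qed

lemma node_without_v: "T \<in> node n \<Longrightarrow> v \<notin> T \<Longrightarrow> T \<in> Y"
  using t_tube(1) by (elim node_cases) (auto simp: low_def)

lemma node_with_v:
  assumes "T \<in> node n" "v \<in> T"
  obtains i where "i \<in> high n" "T = insert v (t i)"
  using assms(1)
proof (cases rule: node_cases)
  case tube
  then show ?thesis using YD(4)[of T] assms(2) by simp
next
  case (low i)
  then show ?thesis using t_subset(2)[of i] assms(2) by (simp add: low_def)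
qed (rule that)

lemma node_tubing:
  assumes n: "n \<le> 2 * k"
  shows "node n \<in> tubings E (insert v V)"
proof (rule tubingsI)
  fix T assume T: "T \<in> node n"
  show "T \<subseteq> insert v V \<and> conn E T"
  proof (cases "v \<in> T")
    case True
    with T obtain i where "i \<in> high n" "T = insert v (t i)" by (rule node_with_v)
    then show ?thesis using t_subset(1)[of i] conn_insert_t[of i] by (auto simp: high_def)
  next
    case False
    then have "T \<in> Y" using T node_without_v by blast
    then show ?thesis using YD(1,2)[of T] by blast
  qed
next
  fix S T assume S: "S \<in> node n" and T: "T \<in> node n"
  show "S \<subseteq> T \<or> T \<subseteq> S \<or> \<not> touch E S T"
  proof (cases "v \<in> S"; cases "v \<in> T")
    assume v: "v \<in> S" "v \<in> T"
    obtain i where i: "i \<in> high n" "S = insert v (t i)" using S v(1) by (rule node_with_v)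
    obtain j where j: "j \<in> high n" "T = insert v (t j)" using T v(2) by (rule node_with_v)
    show ?thesis using i j t_mono[of i j] t_mono[of j i]
      by (cases "i \<le> j") (auto simp: high_def)
  next
    assume v: "v \<in> S" "v \<notin> T"
    obtain i where i: "i \<in> high n" "S = insert v (t i)" using S v(1) by (rule node_with_v)
    then show ?thesis using node_compatible[OF T v(2) i(1)] by blast
  next
    assume v: "v \<notin> S" "v \<in> T"
    obtain j where j: "j \<in> high n" "T = insert v (t j)" using T v(2) by (rule node_with_v)
    then show ?thesis using node_compatible[OF S v(1) j(1)] touch_commute[of S T] by blast
  next
    assume "v \<notin> S" "v \<notin> T"
    then have "S \<in> Y" "T \<in> Y" using S T node_without_v by blast+
    then show ?thesis by (rule tubings_compatible[OF Y])
  qed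
next
  \<comment> \<open>The bound on \<open>n\<close> puts \<open>k\<close> into \<open>high n\<close>,
    so the component of \<open>v\<close> is never lost.\<close>
  have "insert v C0 \<in> node n" using insert_t_in_node[of k n] t_k n by simp
  moreover have "C \<in> node n" if "C \<in> comps E V" "\<not> hits C" for C
  proof -
    have "C \<in> Y" using tubings_comps[OF Y that(1)] .
    moreover from this have "C \<noteq> {}" by (rule YD(3))
    ultimately show ?thesis using that by (simp add: node_def chain_def)
  qed
  ultimately show "comps E (insert v V) \<subseteq> node n" using comps_insert by auto
qed

lemma proj_node: "proj (node n) = Y"
proof
  show "proj (node n) \<subseteq> Y"
  proof
    fix T assume "T \<in> proj (node n)"
    then obtain S where S: "S \<in> node n" "T = S - {v}" "T \<noteq> {}" by (auto simp: proj_def)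
    show "T \<in> Y"
    proof (cases "v \<in> S")
      case True
      with S(1) obtain i where i: "i \<in> high n" "S = insert v (t i)" by (rule node_with_v)
      then have "T = t i" using S(2) t_subset(2)[of i] by (simp add: high_def)
      then show ?thesis using S(3) t_0 t_tube(1)[of i] i by (cases "i = 0") (auto simp: high_def)
    next
      case False
      then show ?thesis using S node_without_v by simp
    qed
  qed
  show "Y \<subseteq> proj (node n)"
  proof
    fix T assume T: "T \<in> Y"
    have "\<exists>S\<in>node n. T = S - {v}"
    proof (cases "T \<in> chain Y")
      case False
      then have "T \<in> node n" using T by (simp add: node_def)
      then show ?thesis using YD(4)[OF T] by (intro bexI[of _ T]) auto
    next
      case True
      with T obtain i where i: "1 \<le> i" "i \<le> k" "T = t i" by (rule tube_in_chainE)
      then have "T \<in> node n \<or> insert v T \<in> node n"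
        using insert_t_in_node[of i n] t_in_node[of i n] by auto
      moreover have "T = T - {v}" "T = insert v T - {v}" using YD(4)[OF T] by simp_all
      ultimately show ?thesis by metis
    qed
    then show "T \<in> proj (node n)" using YD(3)[OF T] by (auto simp: proj_def)
  qed
qed

text \<open>Projecting to \<open>Y\<close> forces each index into \<open>D\<close> or
  \<open>U\<close>, and compatibility puts all of \<open>D\<close> weakly below all of
  \<open>U\<close>. So \<open>D\<close> is an initial and \<open>U\<close> a final segment, and they
  overlap in at most one index.\<close>

lemma node_surj:
  assumes Z: "Z \<in> tubings E (insert v V)" and proj: "proj Z = Y"
  shows "\<exists>n\<le>2 * k. Z = node n"
proof -
  \<comment> \<open>Index 0 belongs to \<open>D\<close> by convention, so that the maximum exists
    and \<open>D \<union> U\<close> covers everything.\<close>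
  define D where "D = {i. i \<le> k \<and> (i = 0 \<or> t i \<in> Z)}"
  define U where "U = {i. i \<le> k \<and> insert v (t i) \<in> Z}"
  have fin: "finite D" "finite U" by (auto simp: D_def U_def)
  have cover: "i \<in> D \<or> i \<in> U" if "i \<le> k" for i
  proof (cases "i = 0")
    case False
    then have "t i \<in> proj Z" using t_tube(1)[of i] that proj by simp
    then obtain T where "T \<in> Z" "t i = T - {v}" by (auto simp: proj_def)
    then have "T = t i \<or> T = insert v (t i)" by auto
    then show ?thesis using \<open>T \<in> Z\<close> that by (auto simp: D_def U_def)
  qed (simp add: D_def)
  have DU: "i \<le> j" if "i \<in> D" "j \<in> U" for i j
  proof (cases "i = 0")
    case False
    then have i: "1 \<le> i" "i \<le> k" "t i \<in> Z" and j: "j \<le> k" "insert v (t j) \<in> Z"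
      using that by (auto simp: D_def U_def)
    then have "touch E (insert v (t j)) (t i)"
      using t_tube(2)[of i] t_subset(1)[of i] touch_insert_v by simp
    then have "t i \<subseteq> insert v (t j)"
      using tubings_compatible[OF Z i(3) j(2)] t_subset(2)[OF i(2)] touch_commute[of "t i"] by blast
    then have "t i \<subseteq> t j" using t_subset(2)[OF i(2)] by blast
    then show ?thesis using t_le i(2) j(1) by simp
  qed simp
  have "insert v (t k) \<in> Z" using tubings_comps[OF Z insert_C0_comp] t_k by simp
  then have kU: "k \<in> U" by (simp add: U_def)
  have D0: "0 \<in> D" by (simp add: D_def)
  define m where "m = Max D"
  define l where "l = Min U"
  have m: "m \<in> D" "i \<in> D \<Longrightarrow> i \<le> m" for i
    using fin D0 by (auto simp: m_def intro: Max_in)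
  have l: "l \<in> U" "i \<in> U \<Longrightarrow> l \<le> i" for i
    using fin kU by (auto simp: l_def intro: Min_in)
  have mk: "m \<le> k" "l \<le> k" using m(1) l(1) by (auto simp: D_def U_def)
  have ml: "m \<le> l" using DU[OF m(1) l(1)] .
  have "l \<le> Suc m"
  proof (cases "m = k")
    case False
    then have "Suc m \<in> U" using cover[of "Suc m"] mk m(2)[of "Suc m"] by auto
    then show ?thesis by (rule l(2))
  qed (use mk in simp)
  then have lm: "l = m \<or> l = Suc m" using ml by linarith
  have D_eq: "i \<in> D \<longleftrightarrow> i \<le> m" if "i \<le> k" for i
    using cover[OF that] m(1) m(2)[of i] DU[of m i] by (cases "i = m") auto
  have U_eq: "i \<in> U \<longleftrightarrow> l \<le> i" if "i \<le> k" for i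
    using cover[OF that] l(1) l(2)[of i] DU[of i l] by (cases "i = l") auto
  have Dn: "i \<in> D \<longleftrightarrow> 2 * i \<le> m + l" if "i \<le> k" for i
    using D_eq[OF that] lm by auto
  have Un: "i \<in> U \<longleftrightarrow> m + l \<le> 2 * i" if "i \<le> k" for i
    using U_eq[OF that] lm by auto
  \<comment> \<open>The sum encodes both cases: it is \<open>2 * m\<close> if the segments share the
    index \<open>m\<close>, and \<open>2 * m + 1\<close> if \<open>U\<close> starts right after
    \<open>D\<close> ends.\<close>
  have "Z = node (m + l)"
  proof (intro equalityI subsetI)
    fix T assume T: "T \<in> Z"
    have TV: "T \<subseteq> insert v V" "conn E T" using tubings_member[OF Z T] by simp_all
    have Tp: "T - {v} \<in> Y" if "T - {v} \<noteq> {}" using T proj that by (auto simp: proj_def)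
    show "T \<in> node (m + l)"
    proof (cases "v \<in> T")
      case True
      have "T - {v} \<in> chain Y"
        using Tp hits_Diff[OF TV(2,1) True] by (cases "T - {v} = {}") (simp_all add: chain_def)
      then obtain i where i: "i \<le> k" "T - {v} = t i" by (rule chainE)
      then have "T = insert v (t i)" using True by blast
      then show ?thesis using insert_t_in_node[of i] Un[of i] i T by (simp add: U_def)
    next
      case False
      then have TY: "T \<in> Y" using Tp conn_nonempty[OF TV(2)] by simp
      show ?thesis
      proof (cases "T \<in> chain Y")
        case True
        with TY obtain i where "1 \<le> i" "i \<le> k" "T = t i" by (rule tube_in_chainE)
        then show ?thesis using t_in_node[of i] Dn[of i] T by (simp add: D_def)
      next
        case False
        then show ?thesis using TY by (simp add: node_def)
      qed
    qed
  next
    fix T assume "T \<in> node (m + l)"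
    then show "T \<in> Z"
    proof (cases rule: node_cases)
      case tube
      then have T: "T \<in> proj Z" "\<not> hits T" "T \<noteq> {}" using YD(3)[of T] proj by (auto simp: chain_def)
      then obtain S where S: "S \<in> Z" "T = S - {v}" by (auto simp: proj_def)
      \<comment> \<open>A tube containing \<open>v\<close> and further vertices contains a neighbour
        of \<open>v\<close>, but \<open>T\<close> has none.\<close>
      then have "v \<notin> S" using hits_Diff[of S] tubings_member[OF Z S(1)] T by blast
      then show ?thesis using S by simp
    next
      case (low i)
      then show ?thesis using Dn[of i] by (simp add: low_def D_def)
    next
      case (high i)
      then show ?thesis using Un[of i] by (simp add: high_def U_def)
    qed
  qed
  then show ?thesis using mk by (intro exI[of _ "m + l"]) simp
qed

lemma node_adjacent:
  assumes n: "Suc n \<le> 2 * k"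
  shows "adjacent (node n) (node (Suc n))"
proof (cases "even n")
  case True
  then obtain i where i: "n = 2 * i" by blast
  have "low (Suc n) = low n" "high n = insert i (high (Suc n))"
    using n i by (auto simp: low_def high_def)
  then have "node n = insert (insert v (t i)) (node (Suc n))" by (simp add: node_def)
  moreover have "insert v (t i) \<notin> node (Suc n)" using insert_t_in_node[of i "Suc n"] n i by simp
  ultimately show ?thesis unfolding adjacent_def by blast
next
  case False
  then obtain i where i: "n = Suc (2 * i)" by (metis oddE Suc_eq_plus1)
  have "n \<le> 2 * j \<longleftrightarrow> Suc n \<le> 2 * j" for j
    using i by presburger
  then have "low (Suc n) = insert (Suc i) (low n)" "high n = high (Suc n)"
    using n i by (auto simp: low_def high_def)
  then have "node (Suc n) = insert (t (Suc i)) (node n)" by (simp add: node_def)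
  moreover have "t (Suc i) \<notin> node n" using t_in_node[of "Suc i" n] n i by simp
  ultimately show ?thesis unfolding adjacent_def by blast
qed

text \<open>The step after \<open>m\<close> makes a permanent change: for even \<open>m\<close> a
  tube with \<open>v\<close> disappears for good, for odd \<open>m\<close> a tube without
  \<open>v\<close> appears for good.\<close>

lemma node_neq:
  assumes "m < n" "n \<le> 2 * k"
  shows "node m \<noteq> node n"
proof (cases "even m")
  case True
  then obtain i where "m = 2 * i" by blast
  then show ?thesis using insert_t_in_node[of i m] insert_t_in_node[of i n] assms by auto
next
  case False
  then obtain i where "m = Suc (2 * i)" by (metis oddE Suc_eq_plus1)
  then show ?thesis using t_in_node[of "Suc i" m] t_in_node[of "Suc i" n] assms by auto
qed

lemma node_0: "node 0 = first Y"
proof -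
  have "low 0 = {}" "high 0 = {..k}" by (auto simp: low_def high_def)
  then show ?thesis by (simp add: node_def first_def t[symmetric] image_image)
qed

lemma node_last: "node (2 * k) = final Y"
proof -
  have low: "low (2 * k) = {1..k}" and high: "high (2 * k) = {k}"
    by (auto simp: low_def high_def)
  have "(Y - chain Y) \<union> t ` {1..k} = Y"
  proof (intro equalityI subsetI)
    fix T assume T: "T \<in> Y"
    show "T \<in> (Y - chain Y) \<union> t ` {1..k}"
    proof (cases "T \<in> chain Y")
      case True
      with T obtain i where "1 \<le> i" "i \<le> k" "T = t i" by (rule tube_in_chainE)
      then show ?thesis by simp
    qed (use T in simp)
  qed (use t_tube(1) in auto)
  then show ?thesis by (simp add: node_def low high final_def t_k)
qed

lemma node_path:
  "\<exists>L. L \<noteq> [] \<and> distinct L \<and> set L = {X \<in> tubings E (insert v V). proj X = Y} \<and>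
    successively adjacent L \<and> hd L = first Y \<and> last L = final Y"
proof -
  let ?L = "map node [0..<Suc (2 * k)]"
  have set_eq: "set [0..<Suc (2 * k)] = {..2 * k}" by auto
  have "inj_on node {..2 * k}"
    by (rule linorder_inj_onI) (use node_neq in auto)
  then have "distinct ?L" by (simp only: distinct_map set_eq distinct_upt simp_thms)
  moreover have "node ` {..2 * k} = {X \<in> tubings E (insert v V). proj X = Y}"
  proof (intro equalityI subsetI)
    fix Z assume "Z \<in> {X \<in> tubings E (insert v V). proj X = Y}"
    then obtain n where "n \<le> 2 * k" "Z = node n" using node_surj[of Z] by blast
    then show "Z \<in> node ` {..2 * k}" by simp
  qed (use node_tubing proj_node in auto)
  then have "set ?L = {X \<in> tubings E (insert v V). proj X = Y}"
    by (simp only: set_map set_eq)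
  moreover have "successively adjacent ?L"
    using node_adjacent by (simp add: successively_conv_nth del: upt_Suc)
  moreover have "hd ?L = first Y" using node_0 by (simp add: hd_map del: upt_Suc)
  moreover have "last ?L = final Y" using node_last by simp
  ultimately show ?thesis by (intro exI[of _ ?L]) simp
qed

end

context simplicial_extension
begin

text \<open>The enumeration of the chain disappears from the statement. The ends depend on
  \<open>Y\<close> alone, which allows fibres over adjacent tubings to be linked.\<close>

lemma fibre_path:
  assumes Y: "Y \<in> tubings E V"
  shows "\<exists>L. L \<noteq> [] \<and> distinct L \<and> set L = {X \<in> tubings E (insert v V). proj X = Y} \<and>
    successively adjacent L \<and> hd L = first Y \<and> last L = final Y"
proof -
  have "finite (chain Y)" "chain Y \<noteq> {}" using finite_tubing[OF Y] by (simp_all add: chain_def)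
  then obtain t :: "nat \<Rightarrow> 'v set" and k where "t ` {..k} = chain Y"
    "\<forall>i j. i < j \<longrightarrow> j \<le> k \<longrightarrow> t i \<subset> t j"
    using chain_enumeration[of "chain Y"] chain_total[OF Y] by metis
  then interpret tubing_fibre E V v Y t k
    using Y by unfold_locales auto
  show ?thesis by (rule node_path)
qed

end

section \<open>Hamiltonian paths through tubings\<close>

definition maximal_tubing :: "'v rel \<Rightarrow> 'v set \<Rightarrow> 'v set set \<Rightarrow> bool" where
  "maximal_tubing E V X \<longleftrightarrow> X \<in> tubings E V \<and> (\<forall>Y\<in>tubings E V. X \<subseteq> Y \<longrightarrow> Y = X)"

section \<open>Concatenation of lists in alternating directions\<close>

fun zigzag :: "('a \<Rightarrow> 'b list) \<Rightarrow> bool \<Rightarrow> 'a list \<Rightarrow> 'b list" where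
  "zigzag F b [] = []"
| "zigzag F b (y # ys) = (if b then F y else rev (F y)) @ zigzag F (\<not> b) ys"

lemma set_zigzag: "set (zigzag F b ys) = (\<Union>y\<in>set ys. set (F y))"
  by (induction ys arbitrary: b) auto

lemma distinct_zigzag:
  assumes "distinct ys" "\<And>y. y \<in> set ys \<Longrightarrow> distinct (F y)"
    and "\<And>y z. y \<in> set ys \<Longrightarrow> z \<in> set ys \<Longrightarrow> y \<noteq> z \<Longrightarrow> set (F y) \<inter> set (F z) = {}"
  shows "distinct (zigzag F b ys)"
  using assms
proof (induction ys arbitrary: b)
  case (Cons y ys)
  have "distinct (zigzag F (\<not> b) ys)" using Cons.prems by (intro Cons.IH) auto
  moreover have "set (F y) \<inter> set (zigzag F (\<not> b) ys) = {}"
    using Cons.prems by (fastforce simp: set_zigzag)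
  ultimately show ?case using Cons.prems by auto
qed simp

lemma zigzag_eq_Nil_iff:
  assumes "\<And>y. y \<in> set ys \<Longrightarrow> F y \<noteq> []"
  shows "zigzag F b ys = [] \<longleftrightarrow> ys = []"
  using assms by (cases ys) auto

lemma hd_zigzag:
  assumes "ys \<noteq> []" "F (hd ys) \<noteq> []"
  shows "hd (zigzag F b ys) = (if b then hd (F (hd ys)) else last (F (hd ys)))"
  using assms by (cases ys) (auto simp: hd_rev)

text \<open>The parity of \<open>length ys\<close> decides which end occurs. It is not tracked,
  since either end is good enough in the application.\<close>

lemma last_zigzag:
  assumes "ys \<noteq> []" "\<And>y. y \<in> set ys \<Longrightarrow> F y \<noteq> []"
  shows "last (zigzag F b ys) \<in> {hd (F (last ys)), last (F (last ys))}"
  using assms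
proof (induction ys arbitrary: b rule: list_nonempty_induct)
  case (single y)
  then show ?case by (auto simp: last_rev)
next
  case (cons y ys)
  have "zigzag F (\<not> b) ys \<noteq> []" using cons by (simp add: zigzag_eq_Nil_iff)
  then show ?case using cons.IH[of "\<not> b"] cons by simp
qed

text \<open>Neighbouring lists run in opposite directions, so the links join last to last and head
  to head alternately. Symmetry of \<open>Q\<close> makes the reversed lists paths as well.\<close>

lemma successively_zigzag:
  assumes "successively R ys" "\<And>y. y \<in> set ys \<Longrightarrow> F y \<noteq> []"
    and "\<And>y. y \<in> set ys \<Longrightarrow> successively Q (F y)"
    and "\<And>x y. Q x y \<Longrightarrow> Q y x"
    and "\<And>y z. y \<in> set ys \<Longrightarrow> z \<in> set ys \<Longrightarrow> R y z \<Longrightarrow> Q (hd (F y)) (hd (F z)) \<and> Q (last (F y)) (last (F z))"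
  shows "successively Q (zigzag F b ys)"
  using assms(1-3,5)
proof (induction ys arbitrary: b)
  case (Cons y ys)
  let ?G = "if b then F y else rev (F y)"
  have "successively (\<lambda>x y. Q y x) (F y)"
    using Cons.prems(3)[of y] by (rule successively_mono) (auto intro: assms(4))
  then have "successively Q ?G" using Cons.prems(3)[of y] by (simp add: successively_rev)
  moreover have "successively Q (zigzag F (\<not> b) ys)"
    using Cons.prems by (intro Cons.IH) (auto simp: successively_Cons)
  moreover have "Q (last ?G) (hd (zigzag F (\<not> b) ys))" if "ys \<noteq> []"
  proof -
    have "R y (hd ys)" using Cons.prems(1) that by (simp add: successively_Cons)
    then have "Q (hd (F y)) (hd (F (hd ys))) \<and> Q (last (F y)) (last (F (hd ys)))"
      using Cons.prems(4)[of y "hd ys"] that by simp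
    moreover have "F (hd ys) \<noteq> []" using Cons.prems(2) that by simp
    ultimately show ?thesis using that by (simp add: hd_zigzag last_rev)
  qed
  ultimately show ?case by (cases "ys = []") (auto simp: successively_append_iff)
qed simp

section \<open>Lifting a Hamiltonian path from H - v to H\<close>

context simplicial_extension
begin

text \<open>The new tube shows up as \<open>insert v T\<close> if it contains a neighbour of
  \<open>v\<close>, and as \<open>T\<close> itself otherwise; all other tubes are
  unaffected.\<close>

lemma first_adjacent_insert:
  assumes Y: "Y \<in> tubings E V" "insert T Y \<in> tubings E V" "T \<notin> Y"
  shows "adjacent (first Y) (first (insert T Y))"
proof (cases "hits T")
  case True
  then have "chain (insert T Y) = insert T (chain Y)" by (auto simp: chain_def)
  moreover from this have "insert T Y - chain (insert T Y) = Y - chain Y" using Y(3) by auto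
  ultimately have "first (insert T Y) = insert (insert v T) (first Y)"
    by (simp add: first_def)
  moreover have "insert v T \<notin> first Y"
  proof
    assume "insert v T \<in> first Y"
    moreover have "insert v T \<notin> Y" using tubing_memberD(4)[OF Y(1), of "insert v T"] by auto
    ultimately obtain S where S: "S \<in> chain Y" "insert v T = insert v S"
      unfolding first_def by auto
    have "v \<notin> S" using S(1) tubing_memberD(4)[OF Y(1), of S] by (auto simp: chain_def)
    moreover have "v \<notin> T" using tubing_memberD(4)[OF Y(2), of T] by simp
    ultimately have "T = S" using S(2) by (simp add: insert_ident)
    then show False using S(1) True Y(3) not_hits_empty by (auto simp: chain_def)
  qed
  ultimately show ?thesis using adjacent_insert by simp
next
  case False
  then have "chain (insert T Y) = chain Y" by (auto simp: chain_def)
  moreover have T: "T \<noteq> {}" "v \<notin> T" using tubing_memberD[OF Y(2), of T] by simp_all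
  then have "T \<notin> chain Y" using False by (simp add: chain_def)
  ultimately have "first (insert T Y) = insert T (first Y)"
    by (simp add: first_def insert_Diff_if)
  moreover have "T \<notin> first Y" using T Y(3) by (auto simp: first_def)
  ultimately show ?thesis using adjacent_insert by simp
qed

lemma final_adjacent_insert:
  assumes "insert T Y \<in> tubings E V" "T \<notin> Y"
  shows "adjacent (final Y) (final (insert T Y))"
proof -
  have "v \<notin> T" using tubing_memberD(4)[OF assms(1), of T] by simp
  then have "T \<notin> final Y" using assms(2) unfolding final_def by blast
  then show ?thesis using adjacent_insert[of T "final Y"] by (simp add: final_def insert_commute)
qed

lemma ends_adjacent:
  assumes "Y \<in> tubings E V" "Z \<in> tubings E V" "adjacent Y Z"
  shows "adjacent (first Y) (first Z)" "adjacent (final Y) (final Z)"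
proof -
  from assms(3) obtain T where "T \<notin> Y \<and> Z = insert T Y \<or> T \<notin> Z \<and> Y = insert T Z"
    unfolding adjacent_def by blast
  then show "adjacent (first Y) (first Z)" "adjacent (final Y) (final Z)"
    using first_adjacent_insert final_adjacent_insert assms adjacent_commute by metis+
qed

lemma ends_tubings:
  assumes "Y \<in> tubings E V"
  shows "first Y \<in> tubings E (insert v V)" "proj (first Y) = Y"
    "final Y \<in> tubings E (insert v V)" "proj (final Y) = Y"
proof -
  obtain L where L: "L \<noteq> []" "set L = {X \<in> tubings E (insert v V). proj X = Y}"
    "hd L = first Y" "last L = final Y"
    using fibre_path[OF assms] by blast
  then have "first Y \<in> set L" "final Y \<in> set L" using hd_in_set last_in_set by metis+
  then show "first Y \<in> tubings E (insert v V)" "proj (first Y) = Y"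
    "final Y \<in> tubings E (insert v V)" "proj (final Y) = Y" using L by auto
qed

lemma proj_mono: "X \<subseteq> Z \<Longrightarrow> proj X \<subseteq> proj Z"
  unfolding proj_def by blast

lemma proj_eq_if_maximal:
  assumes "maximal_tubing E V Y" "Z \<in> tubings E (insert v V)" "X \<subseteq> Z" "proj X = Y"
  shows "proj Z = Y"
  using assms proj_tubing proj_mono unfolding maximal_tubing_def by metis

lemma proj_cases:
  assumes "Z \<in> tubings E (insert v V)" "T \<in> Z"
  obtains "v \<notin> T" "T \<in> proj Z" | S where "v \<notin> S" "T = insert v S" "S \<in> chain (proj Z)"
proof (cases "v \<in> T")
  case True
  have T: "conn E T" "T \<subseteq> insert v V" using tubings_member[OF assms] by simp_all
  have "T - {v} \<in> chain (proj Z)"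
  proof (cases "T - {v} = {}")
    case False
    then show ?thesis using hits_Diff[OF T True] assms by (auto simp: chain_def proj_def)
  qed (simp add: chain_def)
  then show thesis using True by (intro that(2)[of "T - {v}"]) auto
next
  case False
  moreover have "T \<noteq> {}" using conn_nonempty[OF tubings_member(2)[OF assms]] .
  moreover have "T = T - {v}" using False by simp
  ultimately show thesis using assms(2) by (intro that(1)) (auto simp: proj_def)
qed

text \<open>By maximality of \<open>Y\<close>, a larger tubing still projects to \<open>Y\<close>.
  It contains \<open>{v}\<close>, which is incompatible with every tube that has a neighbour of
  \<open>v\<close> but not \<open>v\<close>; what remains is in \<open>first Y\<close>.\<close>

lemma first_maximal:
  assumes Y: "maximal_tubing E V Y"
  shows "maximal_tubing E (insert v V) (first Y)"
proof -
  have YT: "Y \<in> tubings E V" using Y by (simp add: maximal_tubing_def)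
  have "Z \<subseteq> first Y" if Z: "Z \<in> tubings E (insert v V)" "first Y \<subseteq> Z" for Z
  proof
    fix T assume T: "T \<in> Z"
    have pZ: "proj Z = Y" using proj_eq_if_maximal[OF Y Z] ends_tubings[OF YT] by blast
    from Z(1) T show "T \<in> first Y"
    proof (cases rule: proj_cases)
      case 1
      have TV: "T \<subseteq> V" "T \<in> Y" "T \<noteq> {}" using tubing_memberD[OF YT] 1 pZ by auto
      have "{v} \<in> Z" using Z(2) by (auto simp: first_def chain_def)
      then have "T \<subseteq> {v} \<or> {v} \<subseteq> T \<or> \<not> touch E {v} T"
        using tubings_compatible[OF Z(1) T \<open>{v} \<in> Z\<close>] touch_commute[of T] by blast
      then have "\<not> touch E {v} T" using 1(1) TV v_notin by blast
      then have "\<not> hits T" using touch_insert_v[OF TV(1), of "{}"] by blast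
      then show ?thesis using TV by (simp add: first_def chain_def)
    next
      case (2 S)
      then show ?thesis using pZ by (simp add: first_def)
    qed
  qed
  then show ?thesis using ends_tubings[OF YT] unfolding maximal_tubing_def by blast
qed

text \<open>A larger tubing still projects to \<open>Y\<close>. If \<open>C0\<close> is nonempty, it
  is one of its tubes and touches each \<open>insert v S\<close>; nesting then forces
  \<open>S = C0\<close>.\<close>

lemma final_maximal:
  assumes Y: "maximal_tubing E V Y"
  shows "maximal_tubing E (insert v V) (final Y)"
proof -
  have YT: "Y \<in> tubings E V" using Y by (simp add: maximal_tubing_def)
  have "Z \<subseteq> final Y" if Z: "Z \<in> tubings E (insert v V)" "final Y \<subseteq> Z" for Z
  proof
    fix T assume T: "T \<in> Z"
    have pZ: "proj Z = Y" using proj_eq_if_maximal[OF Y Z] ends_tubings[OF YT] by blast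
    from Z(1) T show "T \<in> final Y"
    proof (cases rule: proj_cases)
      case 1
      then show ?thesis using pZ by (simp add: final_def)
    next
      case (2 S)
      have S: "S \<subseteq> C0" using chain_subset_C0[OF YT] 2 pZ by simp
      have "C0 \<subseteq> S"
      proof (cases "C0 = {}")
        case False
        then have C0: "C0 \<in> Y" "hits C0" using C0_in_chain[OF YT] by (auto simp: chain_def)
        then have "touch E (insert v S) C0" using touch_insert_v C0_subset by blast
        moreover have "C0 \<in> Z" using C0 Z(2) by (auto simp: final_def)
        ultimately have "insert v S \<subseteq> C0 \<or> C0 \<subseteq> insert v S"
          using tubings_compatible[OF Z(1) T \<open>C0 \<in> Z\<close>] 2(2) by blast
        then show ?thesis using C0_subset v_notin by blast
      qed simp
      then show ?thesis using S 2 by (simp add: final_def)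
    qed
  qed
  then show ?thesis using ends_tubings[OF YT] unfolding maximal_tubing_def by blast
qed

lemma hamiltonian_path_extend:
  assumes "Ys \<noteq> []" "distinct Ys" "set Ys = tubings E V" "successively adjacent Ys"
    and "maximal_tubing E V (hd Ys)" "maximal_tubing E V (last Ys)"
  shows "\<exists>L. L \<noteq> [] \<and> distinct L \<and> set L = tubings E (insert v V) \<and> successively adjacent L \<and>
    maximal_tubing E (insert v V) (hd L) \<and> maximal_tubing E (insert v V) (last L)"
proof -
  have "\<forall>Y\<in>set Ys. \<exists>L. L \<noteq> [] \<and> distinct L \<and>
      set L = {X \<in> tubings E (insert v V). proj X = Y} \<and> successively adjacent L \<and>
      hd L = first Y \<and> last L = final Y"
    using fibre_path assms(3) by simp
  from bchoice[OF this] obtain F where F: "\<forall>Y\<in>set Ys. F Y \<noteq> [] \<and> distinct (F Y) \<and>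
      set (F Y) = {X \<in> tubings E (insert v V). proj X = Y} \<and> successively adjacent (F Y) \<and>
      hd (F Y) = first Y \<and> last (F Y) = final Y"
    by (elim exE)
  then have Fne: "Y \<in> set Ys \<Longrightarrow> F Y \<noteq> []"
    and Fset: "Y \<in> set Ys \<Longrightarrow> set (F Y) = {X \<in> tubings E (insert v V). proj X = Y}"
    and Fends: "Y \<in> set Ys \<Longrightarrow> hd (F Y) = first Y \<and> last (F Y) = final Y" for Y
    by simp_all
  let ?L = "zigzag F True Ys"
  have "set ?L = tubings E (insert v V)"
  proof (intro equalityI subsetI)
    fix X assume "X \<in> set ?L"
    then show "X \<in> tubings E (insert v V)" using Fset by (auto simp: set_zigzag)
  next
    fix X assume X: "X \<in> tubings E (insert v V)"
    then have "proj X \<in> set Ys" using proj_tubing assms(3) by simp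
    moreover from this have "X \<in> set (F (proj X))" using Fset X by simp
    ultimately show "X \<in> set ?L" by (auto simp: set_zigzag)
  qed
  moreover have "distinct ?L"
    using assms(2)
  proof (rule distinct_zigzag)
    show "distinct (F Y)" if "Y \<in> set Ys" for Y using F that by simp
    \<comment> \<open>Fibres of the function \<open>proj\<close> over different tubings are
      disjoint.\<close>
    show "set (F Y) \<inter> set (F Z) = {}" if "Y \<in> set Ys" "Z \<in> set Ys" "Y \<noteq> Z" for Y Z
      using Fset[OF that(1)] Fset[OF that(2)] that(3) by auto
  qed
  moreover have "?L \<noteq> []" using zigzag_eq_Nil_iff[of Ys F True, OF Fne] assms(1) by simp
  moreover have "successively adjacent ?L"
    using assms(4)
  proof (rule successively_zigzag)
    show "adjacent Y X" if "adjacent X Y" for X Y :: "'v set set"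
      using that adjacent_commute[of X Y] by simp
    show "adjacent (hd (F Y)) (hd (F Z)) \<and> adjacent (last (F Y)) (last (F Z))"
      if "Y \<in> set Ys" "Z \<in> set Ys" "adjacent Y Z" for Y Z
      using ends_adjacent[of Y Z] that Fends[OF that(1)] Fends[OF that(2)] assms(3) by simp
  qed (use F in simp_all)
  moreover have "hd ?L = first (hd Ys)"
    using hd_zigzag[OF assms(1) Fne] Fends[of "hd Ys"] assms(1) by simp
  moreover have "last ?L \<in> {first (last Ys), final (last Ys)}"
    using last_zigzag[of Ys F True, OF assms(1) Fne] Fends[of "last Ys"] assms(1) by simp
  ultimately show ?thesis
    using first_maximal[OF assms(5)] first_maximal[OF assms(6)] final_maximal[OF assms(6)]
    by (intro exI[of _ ?L]) auto
qed

end

lemma (in simple_graph) tubings_hamiltonian_path: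
  assumes "finite V" "hole_free E V"
  shows "\<exists>L. L \<noteq> [] \<and> distinct L \<and> set L = tubings E V \<and> successively adjacent L \<and>
    maximal_tubing E V (hd L) \<and> maximal_tubing E V (last L)"
  using assms
proof (induction "card V" arbitrary: V)
  case 0
  \<comment> \<open>The empty graph has one tubing, the empty family, so the path starts as a single
    vertex that serves as both ends.\<close>
  have "tubings E {} = {{}}" by (auto simp: tubings_def comps_def conn_def)
  moreover have "V = {}" using 0 by simp
  ultimately show ?case by (intro exI[of _ "[{}]"]) (simp add: maximal_tubing_def)
next
  case (Suc n)
  then obtain v where v: "v \<in> V" "simplicial E V v"
    using exists_simplicial[of V] by force
  let ?W = "V - {v}"
  have VW: "insert v ?W = V" using v by blast
  interpret simplicial_extension E ?W v
    using Suc.prems v VW by unfold_locales auto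
  have "n = card ?W" using Suc.hyps(2) Suc.prems v by simp
  then obtain Ys where "Ys \<noteq> []" "distinct Ys" "set Ys = tubings E ?W" "successively adjacent Ys"
    "maximal_tubing E ?W (hd Ys)" "maximal_tubing E ?W (last Ys)"
    using Suc.hyps(1)[of ?W] Suc.prems hole_free_subset[of E V ?W] by auto
  then show ?case using hamiltonian_path_extend[of Ys] unfolding VW by blast
qed

section \<open>The face lattice\<close>

lemma connected_induce_iff:
  assumes "sym (parcs H)"
  shows "Digraph_Component.connected (with_proj H \<restriction> T) \<longleftrightarrow> conn (parcs H) T"
proof -
  let ?R = "parcs H \<inter> T \<times> T"
  \<comment> \<open>The library tests connectedness on the symmetric closure, which adds no arcs to
    a symmetric graph.\<close>
  have arcs: "parcs (mk_symmetric (with_proj H \<restriction> T)) = ?R"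
    using assms by (auto simp: mk_symmetric_def induce_subgraph_def dest: symD)
  have verts: "pverts (mk_symmetric (with_proj H \<restriction> T)) = T"
    by (simp add: mk_symmetric_def)
  have reach: "u \<rightarrow>\<^sup>*\<^bsub>mk_symmetric (with_proj H \<restriction> T)\<^esub> w \<longleftrightarrow> (u, w) \<in> ?R\<^sup>*" if "u \<in> T" for u w
  proof -
    interpret wf_digraph "with_proj (mk_symmetric (with_proj H \<restriction> T))"
      by unfold_locales (auto simp: arcs verts)
    show ?thesis using reachable_conv'[of u w] that by (simp add: arcs verts)
  qed
  have "Digraph_Component.connected (with_proj H \<restriction> T) \<longleftrightarrow>
      T \<noteq> {} \<and> (\<forall>u\<in>T. \<forall>w\<in>T. (u, w) \<in> ?R\<^sup>*)"
    by (simp add: Digraph_Component.connected_def strongly_connected_def verts reach)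
  also have "\<dots> \<longleftrightarrow> conn (parcs H) T"
  proof (intro iffI conjI ballI)
    assume T: "T \<noteq> {} \<and> (\<forall>u\<in>T. \<forall>w\<in>T. (u, w) \<in> ?R\<^sup>*)"
    show "conn (parcs H) T"
    proof (rule connI)
      fix A assume A: "A \<subseteq> T" "A \<noteq> {}"
        and cl: "\<And>x y. x \<in> A \<Longrightarrow> y \<in> T \<Longrightarrow> (x, y) \<in> parcs H \<Longrightarrow> y \<in> A"
      from A(2) obtain a where a: "a \<in> A" by blast
      have "w \<in> A" if "(a, w) \<in> ?R\<^sup>*" for w
        using that by induction (use a cl in auto)
      then show "A = T" using A T a by blast
    qed (use T in blast)
  next
    fix u w assume T: "conn (parcs H) T" and uw: "u \<in> T" "w \<in> T"
    have "{x \<in> T. (u, x) \<in> ?R\<^sup>*} = T"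
    proof (rule connD[OF T])
      fix x y assume "x \<in> {x \<in> T. (u, x) \<in> ?R\<^sup>*}" "y \<in> T" "(x, y) \<in> parcs H"
      then show "y \<in> {x \<in> T. (u, x) \<in> ?R\<^sup>*}" by (auto intro: rtrancl_into_rtrancl)
    qed (use uw in auto)
    then show "(u, w) \<in> ?R\<^sup>*" using uw by blast
  qed (rule conn_nonempty)
  finally show ?thesis .
qed

lemma pair_graph_simple_graph:
  assumes "pair_graph H"
  shows "simple_graph (parcs H)" "finite (pverts H)" "sym (parcs H)"
proof -
  interpret pair_graph H by fact
  show "simple_graph (parcs H)"
    using arcs_symmetric no_loops' by unfold_locales auto
  show "finite (pverts H)" by (rule pair_finite_verts)
  show "sym (parcs H)" using arcs_symmetric by (auto intro: symI)
qed

lemma (in simple_graph) reachable_comp: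
  assumes "E \<subseteq> V \<times> V" "u \<in> V"
  shows "{w. (u, w) \<in> E\<^sup>*} \<in> comps E V"
proof -
  let ?C = "{w. (u, w) \<in> E\<^sup>*}"
  have "sym E" using E_sym by (rule symI)
  then have sym: "(a, b) \<in> E\<^sup>* \<Longrightarrow> (b, a) \<in> E\<^sup>*" for a b using sym_rtrancl[of E] by (blast dest: symD)
  have "w \<in> V" if "(u, w) \<in> E\<^sup>*" for w using that by induction (use assms in auto)
  then have "?C \<subseteq> V" by auto
  moreover have "conn E ?C"
  proof (rule connI)
    fix A assume A: "A \<subseteq> ?C" "A \<noteq> {}"
      and cl: "\<And>x y. x \<in> A \<Longrightarrow> y \<in> ?C \<Longrightarrow> (x, y) \<in> E \<Longrightarrow> y \<in> A"
    from A(2) obtain a where a: "a \<in> A" by blast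
    then have ua: "(u, a) \<in> E\<^sup>*" using A by auto
    have *: "w \<in> A" if "(a, w) \<in> E\<^sup>*" for w
      using that
    proof induction
      case base
      then show ?case using a by simp
    next
      case (step x y)
      have "(u, y) \<in> E\<^sup>*" using ua step.hyps by (meson rtrancl_into_rtrancl rtrancl_trans)
      then show ?case using cl[OF step.IH _ step.hyps(2)] by simp
    qed
    have "?C \<subseteq> A"
    proof
      fix w assume "w \<in> ?C"
      then have "(a, w) \<in> E\<^sup>*" using rtrancl_trans[OF sym[OF ua], of w] by simp
      then show "w \<in> A" by (rule *)
    qed
    then show "A = ?C" using A(1) by (rule equalityI[rotated])
  qed auto
  moreover have "D = ?C" if "conn E D" "?C \<subseteq> D" for D
  proof (rule connD[OF that, symmetric])
    fix x y assume "x \<in> ?C" "y \<in> D" "(x, y) \<in> E"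
    then show "y \<in> ?C" by (auto intro: rtrancl_into_rtrancl)
  qed auto
  ultimately show ?thesis by (simp add: comps_def)
qed

lemma sccs_verts_eq_comps:
  assumes "pair_graph H"
  shows "pre_digraph.sccs_verts (with_proj H) = comps (parcs H) (pverts H)"
proof -
  interpret pair_graph H by fact
  interpret S: simple_graph "parcs H" using pair_graph_simple_graph[OF assms] by simp
  have "parcs H \<subseteq> pverts H \<times> pverts H" using in_arcsD1 in_arcsD2 by auto
  then have comp: "{w. (u, w) \<in> (parcs H)\<^sup>*} \<in> comps (parcs H) (pverts H)" if "u \<in> pverts H" for u
    using S.reachable_comp that by simp
  have scc: "scc_of u = {w. (u, w) \<in> (parcs H)\<^sup>*}" if "u \<in> pverts H" for u
    unfolding scc_of_def using symmetric_reachable' reachable_conv'[OF that] by auto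
  show ?thesis
  proof (intro equalityI subsetI)
    fix C assume "C \<in> sccs_verts"
    then show "C \<in> comps (parcs H) (pverts H)" using comp scc by (auto simp: sccs_verts_conv_scc_of)
  next
    fix C assume C: "C \<in> comps (parcs H) (pverts H)"
    then have "C \<subseteq> pverts H" "C \<noteq> {}" using conn_nonempty[of "parcs H" C] by (simp_all add: comps_def)
    then obtain u where u: "u \<in> C" "u \<in> pverts H" by blast
    have "touch (parcs H) C {w. (u, w) \<in> (parcs H)\<^sup>*}" using u by (auto simp: touch_def)
    then have "C = scc_of u" using S.comps_touch_eq[OF C comp[OF u(2)]] scc[OF u(2)] by simp
    then show "C \<in> sccs_verts" using u by (simp add: sccs_verts_conv_scc_of)
  qed
qed

text \<open>Two differences are bridged: disconnectedness of a union becomes absence of contact, and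
  strict nesting of distinct tubes becomes inclusion.\<close>

lemma tubing_iff:
  assumes "pair_graph H"
  shows "tubing H X \<longleftrightarrow> X \<in> tubings (parcs H) (pverts H)"
proof -
  interpret S: simple_graph "parcs H" using pair_graph_simple_graph[OF assms] by simp
  note conn = connected_induce_iff[OF pair_graph_simple_graph(3)[OF assms]]
  have tube: "tube H T \<longleftrightarrow> T \<subseteq> pverts H \<and> conn (parcs H) T" for T
    using conn_nonempty by (auto simp: tube_def conn)
  have union: "conn (parcs H) (S \<union> T) \<longleftrightarrow> touch (parcs H) S T"
    if "conn (parcs H) S" "conn (parcs H) T" for S T
    using S.conn_Un[OF that] S.touch_if_conn_Un[of S T] that[THEN conn_nonempty] by auto
  have compat: "compatible_tubes H S T \<longleftrightarrow> S \<subset> T \<or> T \<subset> S \<or> \<not> touch (parcs H) S T"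
    if "conn (parcs H) S" "conn (parcs H) T" for S T
    by (simp add: compatible_tubes_def conn union[OF that])
  have "pairwise (compatible_tubes H) X \<longleftrightarrow>
      (\<forall>S\<in>X. \<forall>T\<in>X. S \<subseteq> T \<or> T \<subseteq> S \<or> \<not> touch (parcs H) S T)"
    if X: "\<forall>T\<in>X. tube H T"
  proof -
    have "(S \<noteq> T \<longrightarrow> compatible_tubes H S T) \<longleftrightarrow> S \<subseteq> T \<or> T \<subseteq> S \<or> \<not> touch (parcs H) S T"
      if "S \<in> X" "T \<in> X" for S T
      using compat[of S T] X that tube by auto
    then show ?thesis by (simp add: pairwise_def)
  qed
  then have "tubing H X \<longleftrightarrow> (\<forall>T\<in>X. tube H T) \<and>
      (\<forall>S\<in>X. \<forall>T\<in>X. S \<subseteq> T \<or> T \<subseteq> S \<or> \<not> touch (parcs H) S T) \<and> comps (parcs H) (pverts H) \<subseteq> X"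
    unfolding tubing_def sccs_verts_eq_comps[OF assms] by (simp cong: conj_cong)
  then show ?thesis by (simp add: tubings_def tube)
qed

section \<open>Cycles from vertex lists, and chordality\<close>

lemma pawalk_verts_zip: "pawalk_verts x (zip (x # L) (L @ [y])) = x # L @ [y]"
  by (induction L arbitrary: x) auto

lemma pcas_zip: "pcas x (zip (x # L) (L @ [y])) y"
  by (induction L arbitrary: x) auto

lemma successively_zipD:
  assumes "successively R (x # L @ [y])" "(a, b) \<in> set (zip (x # L) (L @ [y]))"
  shows "R a b"
  using assms by (induction L arbitrary: x) auto

lemma cycle_zip:
  assumes "distinct (x # L)" "set (x # L) \<subseteq> pverts G"
    and "successively (\<lambda>a b. (a, b) \<in> parcs G) (x # L @ [x])"
  shows "pre_digraph.cycle (with_proj G) (zip (x # L) (L @ [x]))"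
  unfolding pre_digraph.cycle_def pre_digraph.awalk_def cas_with_proj_eq awalk_verts_with_proj_eq
proof (intro exI[of _ x] conjI)
  show "set (zip (x # L) (L @ [x])) \<subseteq> arcs (with_proj G)"
    using successively_zipD[OF assms(3)] by auto
  show "pcas x (zip (x # L) (L @ [x])) x" by (rule pcas_zip)
  show "distinct (tl (pawalk_verts x (zip (x # L) (L @ [x]))))"
    unfolding pawalk_verts_zip using assms(1) by simp
  show "zip (x # L) (L @ [x]) \<noteq> []" by (cases L) simp_all
qed (use assms(2) in simp)

lemma fst_set_zip: "fst ` set (zip (x # L) (L @ [y])) = set (x # L)"
proof -
  have "map fst (zip (x # L) (L @ [y])) = x # L" by (rule map_fst_zip) simp
  then show ?thesis by (metis set_map)
qed

text \<open>Two vertices besides \<open>x\<close> give at least three arcs, which rules out an edge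
  walked back and forth.\<close>

lemma has_hamiltonian_cycleI:
  assumes "distinct (x # L)" "set (x # L) = pverts G" "length L \<ge> 2"
    and "successively (\<lambda>a b. (a, b) \<in> parcs G) (x # L @ [x])"
  shows "has_hamiltonian_cycle G"
  unfolding has_hamiltonian_cycle_def
proof (intro exI conjI)
  show "pre_digraph.cycle (with_proj G) (zip (x # L) (L @ [x]))"
    using assms by (intro cycle_zip) simp_all
  show "length (zip (x # L) (L @ [x])) \<ge> 3" using assms(3) by simp
  show "fst ` set (zip (x # L) (L @ [x])) = pverts G"
    unfolding fst_set_zip by (rule assms(2))
qed

text \<open>This separates the two arcs at the closing vertices from those of the path, matching the
  data of \<open>hole_free\<close>.\<close>

lemma set_zip_cycle:
  assumes "p \<noteq> []"
  shows "set (zip (x # p) (p @ [y])) =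
    insert (x, hd p) (insert (last p, y) {(p ! i, p ! Suc i) | i. Suc i < length p})"
  using assms
proof (induction p arbitrary: x rule: list_nonempty_induct)
  case (cons a p)
  have "{(p ! i, p ! Suc i) | i. Suc i < length p} \<union> {(a, hd p)} =
      {((a # p) ! i, (a # p) ! Suc i) | i. Suc i < length (a # p)}" (is "?A = ?B")
  proof (intro equalityI subsetI)
    fix e assume "e \<in> ?A"
    then consider i where "e = (p ! i, p ! Suc i)" "Suc i < length p" | "e = (a, hd p)" by blast
    then show "e \<in> ?B"
    proof cases
      case 1
      then show ?thesis by (intro CollectI exI[of _ "Suc i"]) simp
    next
      case 2
      then show ?thesis using cons.hyps by (intro CollectI exI[of _ 0]) (simp add: hd_conv_nth)
    qed
  next
    fix e assume "e \<in> ?B"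
    then obtain i where i: "e = ((a # p) ! i, (a # p) ! Suc i)" "Suc i < length (a # p)" by blast
    then show "e \<in> ?A" using cons.hyps by (cases i) (auto simp: hd_conv_nth)
  qed
  then show ?case using cons.IH[of a] cons.hyps by auto
qed simp

text \<open>A violation consists of \<open>x\<close> and an induced path \<open>p\<close>. They
  close to a cycle of length \<open>length p + 1\<close>, and the adjacency conditions on
  \<open>p\<close> and on \<open>x\<close> leave no room for a chord.\<close>

lemma chordal_hole_free:
  assumes "pair_graph H" "chordal H"
  shows "hole_free (parcs H) (pverts H)"
  unfolding hole_free_def
proof (intro allI impI notI)
  interpret S: simple_graph "parcs H" using pair_graph_simple_graph[OF assms(1)] by simp
  fix x p
  assume x: "x \<in> pverts H" "set p \<subseteq> pverts H" "x \<notin> set p" and len: "3 \<le> length p"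
    and path: "induced_path (parcs H) p"
    and nbrs: "\<forall>u\<in>set p. ((x, u) \<in> parcs H) = (u = hd p \<or> u = last p)"
  have ne: "p \<noteq> []" using len by auto
  let ?c = "zip (x # p) (p @ [x])"
  have c: "set ?c = insert (x, hd p) (insert (last p, x) {(p ! i, p ! Suc i) | i. Suc i < length p})"
    using ne by (rule set_zip_cycle)
  have dist: "distinct p" and adj: "\<And>i j. i < length p \<Longrightarrow> j < length p \<Longrightarrow>
      (p ! i, p ! j) \<in> parcs H \<longleftrightarrow> j = Suc i \<or> i = Suc j"
    using path by (simp_all add: induced_path_def)
  have ends: "(x, hd p) \<in> parcs H" "(last p, x) \<in> parcs H"
    using nbrs ne S.E_sym by auto
  have "successively (\<lambda>a b. (a, b) \<in> parcs H) p"
    using adj by (simp add: successively_conv_nth)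
  then have "successively (\<lambda>a b. (a, b) \<in> parcs H) (x # p @ [x])"
    using ends ne by (simp add: successively_Cons successively_append_iff)
  then have cyc: "pre_digraph.cycle (with_proj H) ?c"
    using dist x by (intro cycle_zip) auto
  have "arcs (with_proj H \<restriction> set (x # p)) = set ?c \<union> (set ?c)\<inverse>"
  proof (intro equalityI subsetI)
    fix e assume "e \<in> arcs (with_proj H \<restriction> set (x # p))"
    then obtain a b where e: "e = (a, b)" "(a, b) \<in> parcs H" "a = x \<or> a \<in> set p" "b = x \<or> b \<in> set p"
      by (cases e) (auto simp: induce_subgraph_def)
    consider "a = x" "b = x" | "a = x" "b \<in> set p" | "a \<in> set p" "b = x" | "a \<in> set p" "b \<in> set p"
      using e(3,4) by blast
    then show "e \<in> set ?c \<union> (set ?c)\<inverse>"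
    proof cases
      case 1
      then show ?thesis using e S.E_irrefl by simp
    next
      case 2
      then have "b = hd p \<or> b = last p" using nbrs e(2) by simp
      then show ?thesis using 2 e c by auto
    next
      case 3
      then have "a = hd p \<or> a = last p" using nbrs S.E_sym[OF e(2)] by simp
      then show ?thesis using 3 e c by auto
    next
      case 4
      then obtain i j where ij: "i < length p" "j < length p" "a = p ! i" "b = p ! j"
        by (auto simp: in_set_conv_nth)
      then consider "j = Suc i" | "i = Suc j" using adj[of i j] e(2) by auto
      then show ?thesis
      proof cases
        case 1
        then have "(a, b) \<in> set ?c" unfolding c using ij by auto
        then show ?thesis using e(1) by simp
      next
        case 2
        then have "(b, a) \<in> set ?c" unfolding c using ij by auto
        then show ?thesis using e(1) by simp
      qed
    qed
  next
    have arc: "(a, b) \<in> parcs H \<and> a \<in> set (x # p) \<and> b \<in> set (x # p)" if "(a, b) \<in> set ?c" for a b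
    proof -
      from that consider "(a, b) = (x, hd p)" | "(a, b) = (last p, x)"
        | i where "(a, b) = (p ! i, p ! Suc i)" "Suc i < length p"
        unfolding c by auto
      then show ?thesis
      proof cases
        case (3 i)
        then show ?thesis using adj[of i "Suc i"] by simp
      qed (use ends ne in auto)
    qed
    fix e assume "e \<in> set ?c \<union> (set ?c)\<inverse>"
    then obtain a b where e: "e = (a, b)" and "(a, b) \<in> set ?c \<or> (b, a) \<in> set ?c"
      by (cases e) auto
    then have "(a, b) \<in> parcs H \<and> a \<in> set (x # p) \<and> b \<in> set (x # p)"
      using arc[of a b] arc[of b a] S.E_sym[of b a] by blast
    then show "e \<in> arcs (with_proj H \<restriction> set (x # p))" using e by (auto simp: induce_subgraph_def)
  qed
  then have "arcs (with_proj H \<restriction> (fst ` set ?c)) = set ?c \<union> (set ?c)\<inverse>"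
    by (simp only: fst_set_zip)
  moreover have "length ?c \<ge> 4" using len by simp
  ultimately show False using cyc assms(2) unfolding chordal_def by blast
qed

section \<open>The Hamiltonian cycle in the lattice of tubings\<close>

lemma adjacent_covered:
  assumes "tubing H X" "tubing H Y" "adjacent X Y"
  shows "(Some X, Some Y) \<in> parcs (cover_graph (tubing_lattice H) tubing_le)"
proof -
  have *: "covered_by (tubing_lattice H) tubing_le (Some (insert T Z)) (Some Z)"
    if "tubing H Z" "tubing H (insert T Z)" "T \<notin> Z" for T Z
    unfolding covered_by_def
  proof (intro conjI notI)
    assume "\<exists>z\<in>tubing_lattice H. z \<noteq> Some (insert T Z) \<and> z \<noteq> Some Z \<and>
      tubing_le (Some (insert T Z)) z \<and> tubing_le z (Some Z)"
    then obtain z where z: "z \<noteq> Some (insert T Z)" "z \<noteq> Some Z"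
      "tubing_le (Some (insert T Z)) z" "tubing_le z (Some Z)" by blast
    then show False by (cases z) auto
  qed (use that in \<open>auto simp: tubing_lattice_def\<close>)
  show ?thesis using assms * by (auto simp: adjacent_def cover_graph_def)
qed

text \<open>The order reverses inclusion, so an element strictly between \<open>None\<close> and
  \<open>Some X\<close> would be a tubing properly containing \<open>X\<close>.\<close>

lemma maximal_tubing_covered:
  assumes "pair_graph H" "maximal_tubing (parcs H) (pverts H) X"
  shows "(None, Some X) \<in> parcs (cover_graph (tubing_lattice H) tubing_le)"
    "(Some X, None) \<in> parcs (cover_graph (tubing_lattice H) tubing_le)"
proof -
  have X: "tubing H X" "\<And>Y. tubing H Y \<Longrightarrow> X \<subseteq> Y \<Longrightarrow> Y = X"
    using assms by (auto simp: maximal_tubing_def tubing_iff)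
  have "covered_by (tubing_lattice H) tubing_le None (Some X)"
    unfolding covered_by_def using X by (auto simp: tubing_lattice_def)
  then show "(None, Some X) \<in> parcs (cover_graph (tubing_lattice H) tubing_le)"
    "(Some X, None) \<in> parcs (cover_graph (tubing_lattice H) tubing_le)"
    by (simp_all add: cover_graph_def)
qed

text \<open>The components alone form a tubing, and the singleton of a vertex \<open>u\<close> with
  a neighbour \<open>w\<close> can be added: it is not a component, since a component containing
  \<open>u\<close> also contains \<open>w\<close>.\<close>

lemma exists_two_tubings:
  assumes "pair_graph H" "parcs H \<noteq> {}"
  shows "\<exists>X Y. tubing H X \<and> tubing H Y \<and> X \<noteq> Y"
proof -
  let ?E = "parcs H" and ?V = "pverts H"
  interpret pair_graph H by fact
  interpret S: simple_graph ?E using pair_graph_simple_graph[OF assms(1)] by simp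
  obtain u w where uw: "(u, w) \<in> ?E" using assms(2) by auto
  have V: "u \<in> ?V" "w \<in> ?V" using uw in_arcsD1 in_arcsD2 by blast+
  have comp: "C \<subseteq> ?V" "conn ?E C" if "C \<in> comps ?E ?V" for C using that by (auto simp: comps_def)
  have 1: "C \<subseteq> D \<or> D \<subseteq> C \<or> \<not> touch ?E C D" if "C \<in> comps ?E ?V" "D \<in> comps ?E ?V" for C D
    using S.comps_touch_eq[OF that] by auto
  have 2: "{u} \<subseteq> C \<or> \<not> touch ?E C {u}" if "C \<in> comps ?E ?V" for C
    using S.comps_absorb[OF that conn_singleton, of u] V by auto
  then have 3: "{u} \<subseteq> C \<or> \<not> touch ?E {u} C" if "C \<in> comps ?E ?V" for C
    using that by (simp only: S.touch_commute[of "{u}"])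
  have "comps ?E ?V \<in> tubings ?E ?V"
    using comp 1 by (intro tubingsI conjI) simp_all
  moreover have "insert {u} (comps ?E ?V) \<in> tubings ?E ?V"
  proof (rule tubingsI)
    fix A B assume "A \<in> insert {u} (comps ?E ?V)" "B \<in> insert {u} (comps ?E ?V)"
    then show "A \<subseteq> B \<or> B \<subseteq> A \<or> \<not> touch ?E A B"
      using 1[of A B] 2[of A] 3[of B] by (elim insertE) auto
  qed (use comp V conn_singleton in auto)
  moreover have "{u} \<notin> comps ?E ?V"
  proof
    assume "{u} \<in> comps ?E ?V"
    then have "{w} \<subseteq> {u}"
      using S.comps_absorb[OF _ conn_singleton, of "{u}" ?V w] uw V by (simp add: touch_def)
    then show False using uw S.E_irrefl by simp
  qed
  ultimately show ?thesis using tubing_iff[OF assms(1)] insertI1[of "{u}" "comps ?E ?V"] by metis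
qed

text \<open>The vertex list is provided rather than the finished cycle, because it can also be
  mapped along an isomorphism to the faces of a polytope.\<close>

lemma tubing_lattice_hamiltonian_list:
  assumes "pair_graph H" "chordal H" "parcs H \<noteq> {}"
  obtains L where "distinct (None # L)" "set (None # L) = tubing_lattice H" "length L \<ge> 2"
    "successively (\<lambda>a b. (a, b) \<in> parcs (cover_graph (tubing_lattice H) tubing_le)) (None # L @ [None])"
proof -
  let ?R = "\<lambda>a b. (a, b) \<in> parcs (cover_graph (tubing_lattice H) tubing_le)"
  interpret S: simple_graph "parcs H" using pair_graph_simple_graph[OF assms(1)] by simp
  obtain K where K: "K \<noteq> []" "distinct K" "set K = tubings (parcs H) (pverts H)"
    "successively adjacent K" "maximal_tubing (parcs H) (pverts H) (hd K)"
    "maximal_tubing (parcs H) (pverts H) (last K)"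
    using S.tubings_hamiltonian_path[OF pair_graph_simple_graph(2)[OF assms(1)]
        chordal_hole_free[OF assms(1,2)]] by blast
  have set_K: "set K = {X. tubing H X}" using K(3) tubing_iff[OF assms(1)] by auto
  obtain X Y where "X \<in> set K" "Y \<in> set K" "X \<noteq> Y"
    using exists_two_tubings[OF assms(1,3)] set_K by auto
  then have "card {X, Y} = 2" "{X, Y} \<subseteq> set K" by simp_all
  then have "length K \<ge> 2" using card_mono[of "set K" "{X, Y}"] card_length[of K] by simp
  moreover have "distinct (None # map Some K)" using K(2) by (auto simp: distinct_map)
  moreover have "set (None # map Some K) = tubing_lattice H"
    by (simp add: tubing_lattice_def set_K)
  moreover have "successively ?R (None # map Some K @ [None])"
  proof -
    have "successively (\<lambda>X Y. ?R (Some X) (Some Y)) K"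
      using K(4) by (rule successively_mono) (use set_K in \<open>auto intro: adjacent_covered\<close>)
    then have "successively ?R (map Some K)" by (simp add: successively_map)
    then show ?thesis
      using K(1) maximal_tubing_covered[OF assms(1) K(5)] maximal_tubing_covered[OF assms(1) K(6)]
      by (simp add: successively_Cons successively_append_iff hd_map last_map)
  qed
  ultimately show thesis by (intro that[of "map Some K"]) simp_all
qed

lemma covered_by_image:
  assumes g: "bij_betw g A B" and mono: "\<And>x y. x \<in> A \<Longrightarrow> y \<in> A \<Longrightarrow> le x y \<longleftrightarrow> le' (g x) (g y)"
    and "covered_by A le x y"
  shows "covered_by B le' (g x) (g y)"
proof -
  have xy: "x \<in> A" "y \<in> A" "x \<noteq> y" "le x y" "\<not> (\<exists>z\<in>A. z \<noteq> x \<and> z \<noteq> y \<and> le x z \<and> le z y)"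
    using assms(3) by (simp_all add: covered_by_def)
  have inj: "inj_on g A" and img: "g ` A = B" using g by (simp_all add: bij_betw_def)
  show ?thesis
    unfolding covered_by_def
  proof (intro conjI notI)
    show "g x \<in> B" "g y \<in> B" using xy img by auto
    show "le' (g x) (g y)" using xy mono by simp
    show False if "g x = g y" using that xy inj by (simp add: inj_on_eq_iff)
    assume "\<exists>z\<in>B. z \<noteq> g x \<and> z \<noteq> g y \<and> le' (g x) z \<and> le' z (g y)"
    then obtain z where "z \<in> A" "g z \<noteq> g x" "g z \<noteq> g y" "le' (g x) (g z)" "le' (g z) (g y)"
      using img by blast
    then show False using xy mono by metis
  qed
qed

text \<open>The first conjunct concerns the lattice itself and does not presuppose a polytope that
  realises it; the second transfers the cycle to the faces of every such polytope.\<close>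

theorem theorem17:
  fixes H :: "'v pair_pre_digraph"
  assumes "pair_graph H"
    and "chordal H"
    and "parcs H \<noteq> {}"
  shows "has_hamiltonian_cycle (cover_graph (tubing_lattice H) tubing_le) \<and>
    (\<forall>P :: 'n::euclidean_space set. graph_associahedron H P \<longrightarrow>
       has_hamiltonian_cycle (cover_graph {F. F face_of P} (\<subseteq>)))"
proof (intro conjI allI impI)
  let ?R = "\<lambda>a b. (a, b) \<in> parcs (cover_graph (tubing_lattice H) tubing_le)"
  obtain L where L: "distinct (None # L)" "set (None # L) = tubing_lattice H" "length L \<ge> 2"
    "successively ?R (None # L @ [None])"
    using assms by (rule tubing_lattice_hamiltonian_list)
  show "has_hamiltonian_cycle (cover_graph (tubing_lattice H) tubing_le)"
    by (rule has_hamiltonian_cycleI[of None L]) (use L in \<open>simp_all add: cover_graph_def\<close>)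

  fix P :: "'n set" assume "graph_associahedron H P"
  then obtain f where f: "bij_betw f {F. F face_of P} (tubing_lattice H)"
    and mono: "\<And>F G. F face_of P \<Longrightarrow> G face_of P \<Longrightarrow> F \<subseteq> G \<longleftrightarrow> tubing_le (f F) (f G)"
    unfolding graph_associahedron_def by blast
  \<comment> \<open>The given isomorphism leads from faces to tubings, whereas the cycle has to be
    carried the other way.\<close>
  define g where "g = inv_into {F. F face_of P} f"
  have g: "bij_betw g (tubing_lattice H) {F. F face_of P}"
    unfolding g_def using f by (rule bij_betw_inv_into)
  have fg: "f (g x) = x" "g x face_of P" if "x \<in> tubing_lattice H" for x
    using that f g bij_betw_inv_into_right[OF f] bij_betwE[OF g] unfolding g_def by auto
  have g_mono: "tubing_le x y \<longleftrightarrow> g x \<subseteq> g y" if "x \<in> tubing_lattice H" "y \<in> tubing_lattice H" for x y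
    using mono[OF fg(2) fg(2), OF that] fg(1) that by simp
  have g_arc: "(g x, g y) \<in> parcs (cover_graph {F. F face_of P} (\<subseteq>))" if "?R x y" for x y
    using that covered_by_image[where le = tubing_le and le' = "(\<subseteq>)", OF g g_mono] by (auto simp: cover_graph_def)
  show "has_hamiltonian_cycle (cover_graph {F. F face_of P} (\<subseteq>))"
  proof (rule has_hamiltonian_cycleI)
    have "distinct (map g (None # L))"
      unfolding distinct_map using L(1,2) g by (simp add: bij_betw_def del: list.map)
    then show "distinct (g None # map g L)" by simp
    have "set (map g (None # L)) = {F. F face_of P}"
      unfolding set_map L(2) using g by (simp add: bij_betw_def)
    then show "set (g None # map g L) = pverts (cover_graph {F. F face_of P} (\<subseteq>))"
      by (simp add: cover_graph_def)
    have "successively (\<lambda>x y. (g x, g y) \<in> parcs (cover_graph {F. F face_of P} (\<subseteq>)))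
        (None # L @ [None])"
      using L(4) by (rule successively_mono) (rule g_arc)
    then have "successively (\<lambda>x y. (x, y) \<in> parcs (cover_graph {F. F face_of P} (\<subseteq>)))
        (map g (None # L @ [None]))"
      by (simp only: successively_map)
    then show "successively (\<lambda>x y. (x, y) \<in> parcs (cover_graph {F. F face_of P} (\<subseteq>)))
        (g None # map g L @ [g None])"
      by simp
  qed (use L(3) in simp)
qed

end
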